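(* Let $n\ge2$, let $(Y_i,X_i,Z_i,W_i)\in\mathbb{R}\times\mathbb{R}^q\times[0,1]\times\mathbb{R}^p$, $i=1,\dots,n$, and let $\mu$ be a symmetric probability measure on $\mathbb{R}^p$ with support $\mathbb{R}^p$. Let $\bm L$ be the $n\times(q+2)$ matrix whose $i$-th row is $(1,Z_i,X_i^T)$. For any $\lambda>0$, if all $Z_i$'s are different, all $W_i$'s are different, and $\bm L$ has full column rank, then the minimization problem $$\min_{(\gamma,g)\in\mathbb{R}^q\times\mathcal{G}}\ \int\Big|\frac1n\sum_{i=1}^n(Y_i-X_i^T\gamma-g(Z_i))\exp(\mathbf{i}W_i^\top t)\Big|^2d\mu(t)+\lambda\int_0^1|g''(z)|^2dz$$ has a solution $(\widehat\gamma,\widehat g)$ and it is unique. The function $\widehat g$ is a natural cubic spline with knots $Z_1,\dots,Z_n$, $$\widehat g(z)=\widehat a_0+\widehat a_1z+\frac1{12}\sum_{i=1}^n\widehat\delta_i|z-Z_i|^3,$$ and the coefficients $\widehat{\bm a}=(\widehat a_0,\widehat a_1,\widehat\gamma^T)^T$ and $\widehat{\bm\delta}=(\widehat\delta_1,\dots,\widehat\delta_n)^T$ are characterized by $$\begin{bmatrix}\widetilde{\bm E}&\bm L\\ \bm L^T&\bm 0\end{bmatrix}\begin{pmatrix}\widehat{\bm\delta}\\ \widehat{\bm a}\end{pmatrix}=\begin{pmatrix}\bm Y\\ \bm 0\end{pmatrix},\qquad\widetilde{\bm E}=\bm E+\lambda\bm\Omega^{-1}.$$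
   Context: $\mathbf{i}$ is the imaginary unit. $\mathcal{G}$ is the set of differentiable functions $g:[0,1]\to\mathbb{R}$ whose first derivative is absolutely continuous (so $g'(z)-g'(0)=\int_0^zg''(t)dt$ with $g''$ integrable). $\omega(w)=\int_{\mathbb{R}^p}\cos(t^\top w)\,d\mu(t)$. Matrix notation: $\bm Y=(Y_1,\dots,Y_n)^T$; $\bm E$ is the $n\times n$ matrix with entries $\frac1{12}|Z_i-Z_j|^3$; $\bm\Omega$ is the $n\times n$ matrix with entries $n^{-2}\omega(W_i-W_j)$ (invertible under the stated hypotheses). A natural cubic spline with knots $Z_1,\dots,Z_n$ is a function that is a cubic polynomial between consecutive knots, is twice continuously differentiable, and is affine outside the range of the knots (zero second and third derivatives there); equivalently, a function of the form $a_0+a_1z+\frac1{12}\sum_{i=1}^n\delta_i|z-Z_i|^3$ with $\sum_i\delta_i=\sum_i\delta_iZ_i=0$. *)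

theory Defs
  imports "HOL-Analysis.Analysis" "HOL-Probability.Probability"
begin

text \<open>
  Absolute continuity of a function (the library only has it for measures). A
  \<open>division_of\<close> is a finite family of non-overlapping compact intervals, and for
  such an interval \<open>K\<close> the end points are \<open>Inf K\<close> and \<open>Sup K\<close>.
\<close>

definition abs_continuous_on :: "real set \<Rightarrow> (real \<Rightarrow> real) \<Rightarrow> bool" where
  "abs_continuous_on S f \<longleftrightarrow>
     (\<forall>\<epsilon>>0. \<exists>\<delta>>0. \<forall>D. D division_of \<Union>D \<and> \<Union>D \<subseteq> S \<and> (\<Sum>K\<in>D. Sup K - Inf K) < \<delta> \<longrightarrow>
        (\<Sum>K\<in>D. \<bar>f (Sup K) - f (Inf K)\<bar>) < \<epsilon>)"

text \<open>The derivative of a function on \<open>[0,1]\<close>, one-sided at the end points.\<close>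

definition deriv01 :: "(real \<Rightarrow> real) \<Rightarrow> real \<Rightarrow> real" where
  "deriv01 g z = vector_derivative g (at z within {0..1})"

text \<open>
  A function \<open>[0,1] \<rightarrow> \<real>\<close> is represented by a function on \<open>\<real>\<close> that is
  \<open>undefined\<close> outside \<open>[0,1]\<close>, so that equality in the class below is equality on \<open>[0,1]\<close>.
\<close>

definition smooth_class :: "(real \<Rightarrow> real) set" where
  "smooth_class =
     {g \<in> extensional {0..1}. g differentiable_on {0..1} \<and> abs_continuous_on {0..1} (deriv01 g)}"

text \<open>
  The second derivative of a member of the class: the integrable density of its first
  derivative. It is determined up to a Lebesgue null set of \<open>[0,1]\<close>, and it is only used
  inside an integral over \<open>[0,1]\<close>.
\<close>

definition second_deriv01 :: "(real \<Rightarrow> real) \<Rightarrow> real \<Rightarrow> real" where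
  "second_deriv01 g =
     (SOME h. set_integrable lborel {0..1} h \<and>
        (\<forall>z\<in>{0..1}. deriv01 g z - deriv01 g 0 = set_lebesgue_integral lborel {0..z} h))"

text \<open>
  The integral of \<open>|g''|\<^sup>2\<close> may be infinite, hence the objective takes values in \<open>[0,\<infinity>]\<close>.
\<close>

definition objective ::
  "(real^'p) measure \<Rightarrow> real \<Rightarrow> real^'n \<Rightarrow> real^'q^'n \<Rightarrow> real^'n \<Rightarrow> real^'p^'n \<Rightarrow>
   real^'q \<Rightarrow> (real \<Rightarrow> real) \<Rightarrow> ennreal" where
  "objective \<mu> lam Y X Z W \<gamma> g =
     (\<integral>\<^sup>+ t. ennreal ((cmod (1 / of_nat CARD('n) *
        (\<Sum>i\<in>UNIV. complex_of_real (Y $ i - X $ i \<bullet> \<gamma> - g (Z $ i)) *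
           exp (\<i> * complex_of_real (W $ i \<bullet> t)))))\<^sup>2) \<partial>\<mu>)
     + ennreal lam * (\<integral>\<^sup>+ z\<in>{0..1}. ennreal (\<bar>second_deriv01 g z\<bar>\<^sup>2) \<partial>lborel)"

definition is_solution ::
  "(real^'p) measure \<Rightarrow> real \<Rightarrow> real^'n \<Rightarrow> real^'q^'n \<Rightarrow> real^'n \<Rightarrow> real^'p^'n \<Rightarrow>
   real^'q \<Rightarrow> (real \<Rightarrow> real) \<Rightarrow> bool" where
  "is_solution \<mu> lam Y X Z W \<gamma> g \<longleftrightarrow>
     is_arg_min (\<lambda>(\<gamma>, g). objective \<mu> lam Y X Z W \<gamma> g) (\<lambda>(\<gamma>, g). g \<in> smooth_class) (\<gamma>, g)"

definition measure_support :: "'a::topological_space measure \<Rightarrow> 'a set" where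
  "measure_support \<mu> = {x. \<forall>U. open U \<and> x \<in> U \<longrightarrow> emeasure \<mu> U > 0}"

definition symmetric_measure :: "'a::real_normed_vector measure \<Rightarrow> bool" where
  "symmetric_measure \<mu> \<longleftrightarrow> distr \<mu> borel uminus = \<mu>"

definition natural_cubic_spline :: "real set \<Rightarrow> (real \<Rightarrow> real) \<Rightarrow> bool" where
  "natural_cubic_spline K s \<longleftrightarrow>
     (\<forall>a\<in>K. \<forall>b\<in>K. a < b \<and> K \<inter> {a<..<b} = {} \<longrightarrow>
        (\<exists>p :: real poly. degree p \<le> 3 \<and> (\<forall>x\<in>{a..b}. s x = poly p x))) \<and>
     (\<exists>s' s''. (\<forall>x. (s has_real_derivative s' x) (at x)) \<and>
        (\<forall>x. (s' has_real_derivative s'' x) (at x)) \<and> continuous_on UNIV s'') \<and>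
     (\<exists>c d. \<forall>x\<le>Min K. s x = c + d * x) \<and>
     (\<exists>c d. \<forall>x\<ge>Max K. s x = c + d * x)"

definition cubic_form :: "real^'n \<Rightarrow> real \<Rightarrow> real \<Rightarrow> real^'n \<Rightarrow> real \<Rightarrow> real" where
  "cubic_form Z a\<^sub>0 a\<^sub>1 \<delta> z = a\<^sub>0 + a\<^sub>1 * z + 1 / 12 * (\<Sum>i\<in>UNIV. \<delta> $ i * \<bar>z - Z $ i\<bar> ^ 3)"

definition vec_join :: "'a^'m \<Rightarrow> 'a^'k \<Rightarrow> 'a^('m + 'k)" where
  "vec_join u v = (\<chi> l. case l of Inl i \<Rightarrow> u $ i | Inr j \<Rightarrow> v $ j)"

definition block_matrix ::
  "'a^'k^'m \<Rightarrow> 'a^'l^'m \<Rightarrow> 'a^'k^'r \<Rightarrow> 'a^'l^'r \<Rightarrow> 'a^('k + 'l)^('m + 'r)" where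
  "block_matrix A B C D =
     vec_join (\<chi> i. vec_join (A $ i) (B $ i)) (\<chi> i. vec_join (C $ i) (D $ i))"

definition E_matrix :: "real^'n \<Rightarrow> real^'n^'n" where
  "E_matrix Z = (\<chi> i j. 1 / 12 * \<bar>Z $ i - Z $ j\<bar> ^ 3)"

definition omega :: "(real^'p) measure \<Rightarrow> real^'p \<Rightarrow> real" where
  "omega \<mu> w = (\<integral>t. cos (t \<bullet> w) \<partial>\<mu>)"

definition Omega_matrix :: "(real^'p) measure \<Rightarrow> real^'p^'n \<Rightarrow> real^'n^'n" where
  "Omega_matrix \<mu> W = (\<chi> i j. omega \<mu> (W $ i - W $ j) / (real CARD('n))\<^sup>2)"

text \<open>The \<open>q + 2\<close> columns are indexed by the sum of the two-element type \<open>2\<close> and \<open>'q\<close>.\<close>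

definition L_matrix :: "real^'q^'n \<Rightarrow> real^'n \<Rightarrow> real^(2 + 'q)^'n" where
  "L_matrix X Z = (\<chi> i. vec_join (vector [1, Z $ i]) (X $ i))"

definition E_tilde :: "(real^'p) measure \<Rightarrow> real \<Rightarrow> real^'n \<Rightarrow> real^'p^'n \<Rightarrow> real^'n^'n" where
  "E_tilde \<mu> lam Z W = E_matrix Z + lam *\<^sub>R matrix_inv (Omega_matrix \<mu> W)"

end

theory Submission
  imports Defs
begin

text \<open>
  Write \<open>r\<close> for the residual vector \<open>Y - X\<gamma> - g(Z)\<close>. The data term is the quadratic form \<open>r \<bullet> \<Omega>r\<close>,
  which is positive definite since distinct characters are linearly independent and \<open>\<mu>\<close> has full
  support. If \<open>\<Sum>\<delta>\<^sub>i = \<Sum>\<delta>\<^sub>iZ\<^sub>i = 0\<close>, then Taylor's formula with integral remainder gives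
  \<open>\<Sum>\<delta>\<^sub>ig(Z\<^sub>i) = \<integral>s\<^sub>\<delta> g''\<close> with \<open>s\<^sub>\<delta>(z) = \<Sum>\<delta>\<^sub>i\<bar>z - Z\<^sub>i\<bar> / 2\<close>, the second derivative of the cubic form.
  Hence \<open>\<delta> \<bullet> E\<delta> = \<integral>s\<^sub>\<delta>\<^sup>2 \<ge> 0\<close>, so the block system is nonsingular, and its solution has residual
  \<open>\<lambda>\<Omega>\<^sup>-\<^sup>1\<delta>\<close>. Expanding the objective around it, the cross terms cancel, and what is left over is
  \<open>v \<bullet> \<Omega>v + \<lambda>\<integral>(g'' - s\<^sub>\<delta>)\<^sup>2\<close>, where \<open>v\<close> is the difference of the residuals; this vanishes only for
  the solution itself, by the rank condition.

  That a density \<open>g''\<close> exists at all follows from Radon-Nikodym: the absolutely continuous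
  function \<open>g'\<close> is the difference of its positive variation and another increasing absolutely
  continuous function, and the Stieltjes measures of both are absolutely continuous.
\<close>

section \<open>Absolutely continuous functions\<close>

definition nonoverlapping :: "'i set \<Rightarrow> ('i \<Rightarrow> real) \<Rightarrow> ('i \<Rightarrow> real) \<Rightarrow> real set \<Rightarrow> bool" where
  "nonoverlapping I a b S \<longleftrightarrow> finite I \<and> (\<forall>i\<in>I. a i \<le> b i \<and> {a i..b i} \<subseteq> S) \<and>
     disjoint_family_on (\<lambda>i. {a i<..<b i}) I"

lemma nonoverlapping_mono: "nonoverlapping I a b S \<Longrightarrow> S \<subseteq> T \<Longrightarrow> nonoverlapping I a b T"
  unfolding nonoverlapping_def by blast

lemma nonoverlapping_division:
  assumes "D division_of \<Union>D" "\<Union>D \<subseteq> S"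
  shows "nonoverlapping D Inf Sup S"
proof -
  have K: "Inf K \<le> Sup K \<and> {Inf K..Sup K} = K" if "K \<in> D" for K
  proof -
    have "K \<noteq> {}" "\<exists>a b. K = cbox a b"
      using division_ofD(3,4)[OF assms(1) that] by blast+
    then obtain a b where "K = {a..b}" "K \<noteq> {}"
      by auto
    then show ?thesis by simp
  qed
  have "interior K = {Inf K<..<Sup K}" if "K \<in> D" for K
    using K[OF that] interior_atLeastAtMost_real[of "Inf K" "Sup K"] by simp
  then have "disjoint_family_on (\<lambda>i. {Inf i<..<Sup i}) D"
    using division_ofD(5)[OF assms(1)] unfolding disjoint_family_on_def by metis
  moreover have "{Inf K..Sup K} \<subseteq> S" if "K \<in> D" for K
    using K[OF that] assms(2) that by auto
  ultimately show ?thesis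
    using K division_of_finite[OF assms(1)] unfolding nonoverlapping_def by blast
qed

text \<open>Degenerate intervals are dropped; those left have an interior point each, so distinct
  indices give distinct sets. A dropped interval contributes nothing to a sum of
  \<open>\<phi>\<close> because \<open>\<phi>\<close> vanishes on the diagonal. Quantifying over
  \<open>\<phi>\<close> lets one \<open>D\<close> serve both the length sum and the variation
  sum.\<close>

lemma division_of_nonoverlapping:
  assumes "nonoverlapping I a b S"
  obtains D where "D division_of \<Union>D" "\<Union>D \<subseteq> S"
    "\<And>\<phi>::real \<Rightarrow> real \<Rightarrow> real. (\<And>x. \<phi> x x = 0) \<Longrightarrow> (\<Sum>K\<in>D. \<phi> (Inf K) (Sup K)) = (\<Sum>i\<in>I. \<phi> (a i) (b i))"
proof
  let ?J = "{i\<in>I. a i < b i}"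
  let ?K = "\<lambda>i. {a i..b i}"
  have fin: "finite I" and le: "\<And>i. i \<in> I \<Longrightarrow> a i \<le> b i" and sub: "\<And>i. i \<in> I \<Longrightarrow> ?K i \<subseteq> S"
    and disj: "\<And>i j. i \<in> I \<Longrightarrow> j \<in> I \<Longrightarrow> i \<noteq> j \<Longrightarrow> {a i<..<b i} \<inter> {a j<..<b j} = {}"
    using assms unfolding nonoverlapping_def disjoint_family_on_def by blast+
  have inj: "inj_on ?K ?J"
  proof (rule inj_onI, rule ccontr)
    fix i j assume ij: "i \<in> ?J" "j \<in> ?J" "?K i = ?K j" "i \<noteq> j"
    then have "a i = a j" "b i = b j"
      by (simp_all add: Icc_eq_Icc)
    with disj[of i j] ij dense[of "a i" "b i"] show False
      by auto
  qed
  show "?K ` ?J division_of \<Union>(?K ` ?J)"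
  proof (rule division_ofI)
    show "finite (?K ` ?J)" using fin by simp
    show "K \<subseteq> \<Union>(?K ` ?J)" if "K \<in> ?K ` ?J" for K using that by blast
    show "K \<noteq> {}" if "K \<in> ?K ` ?J" for K using that by auto
    show "\<exists>a b. K = cbox a b" if "K \<in> ?K ` ?J" for K using that by (auto simp: cbox_interval)
    show "interior K1 \<inter> interior K2 = {}"
      if K: "K1 \<in> ?K ` ?J" "K2 \<in> ?K ` ?J" "K1 \<noteq> K2" for K1 K2
    proof -
      obtain i j where "K1 = ?K i" "K2 = ?K j" "i \<in> I" "j \<in> I" "i \<noteq> j"
        using K by auto
      then show ?thesis using disj[of i j] by (simp add: interior_atLeastAtMost_real)
    qed
  qed simp
  show "\<Union>(?K ` ?J) \<subseteq> S" using sub by auto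
  fix \<phi> :: "real \<Rightarrow> real \<Rightarrow> real" assume \<phi>: "\<And>x. \<phi> x x = 0"
  have "(\<Sum>K\<in>?K ` ?J. \<phi> (Inf K) (Sup K)) = (\<Sum>i\<in>?J. \<phi> (a i) (b i))"
    by (subst sum.reindex[OF inj]) (auto intro!: sum.cong)
  also have "\<dots> = (\<Sum>i\<in>I. \<phi> (a i) (b i))"
  proof (rule sum.mono_neutral_left[OF fin])
    show "\<forall>i\<in>I - ?J. \<phi> (a i) (b i) = 0"
    proof
      fix i assume "i \<in> I - ?J"
      then have "a i = b i" using le[of i] by auto
      then show "\<phi> (a i) (b i) = 0" using \<phi> by simp
    qed
  qed auto
  finally show "(\<Sum>K\<in>?K ` ?J. \<phi> (Inf K) (Sup K)) = (\<Sum>i\<in>I. \<phi> (a i) (b i))" .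
qed

text \<open>Lebesgue measure is additive over the disjoint interiors.\<close>

lemma nonoverlapping_length_le:
  assumes "nonoverlapping I a b {u..v}" "u \<le> v"
  shows "(\<Sum>i\<in>I. b i - a i) \<le> v - u"
proof -
  have fin: "finite I" and le: "\<And>i. i \<in> I \<Longrightarrow> a i \<le> b i" and sub: "\<And>i. i \<in> I \<Longrightarrow> {a i..b i} \<subseteq> {u..v}"
    and disj: "disjoint_family_on (\<lambda>i. {a i<..<b i}) I"
    using assms unfolding nonoverlapping_def by blast+
  have "ennreal (\<Sum>i\<in>I. b i - a i) = (\<Sum>i\<in>I. emeasure lborel {a i<..<b i})"
    using le by (subst sum_ennreal[symmetric]) (auto intro!: sum.cong)
  also have "\<dots> = emeasure lborel (\<Union>i\<in>I. {a i<..<b i})"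
    by (rule sum_emeasure) (use fin disj in auto)
  also have "\<dots> \<le> emeasure lborel {u..v}"
    by (rule emeasure_mono) (use sub in fastforce)+
  also have "\<dots> = ennreal (v - u)" using assms(2) by simp
  finally show ?thesis using assms(2) by simp
qed

text \<open>Clipping the end points at \<open>v\<close> collapses every interval on the wrong side
  to the single point \<open>v\<close>, which the indexed form tolerates.\<close>

lemma nonoverlapping_split:
  assumes "nonoverlapping I a b {u..w}" "u \<le> v" "v \<le> w"
  shows "nonoverlapping I (\<lambda>i. min (a i) v) (\<lambda>i. min (b i) v) {u..v}"
    and "nonoverlapping I (\<lambda>i. max (a i) v) (\<lambda>i. max (b i) v) {v..w}"
proof -
  have fin: "finite I" and le: "\<And>i. i \<in> I \<Longrightarrow> a i \<le> b i" and sub: "\<And>i. i \<in> I \<Longrightarrow> {a i..b i} \<subseteq> {u..w}"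
    and disj: "\<And>i j. i \<in> I \<Longrightarrow> j \<in> I \<Longrightarrow> i \<noteq> j \<Longrightarrow> {a i<..<b i} \<inter> {a j<..<b j} = {}"
    using assms(1) unfolding nonoverlapping_def disjoint_family_on_def by blast+
  have bds: "u \<le> a i" "b i \<le> w" if "i \<in> I" for i using le[OF that] sub[OF that] by auto
  have "{min (a i) v<..<min (b i) v} \<subseteq> {a i<..<b i}" "{max (a i) v<..<max (b i) v} \<subseteq> {a i<..<b i}" for i
    by auto
  then have "disjoint_family_on (\<lambda>i. {min (a i) v<..<min (b i) v}) I"
    "disjoint_family_on (\<lambda>i. {max (a i) v<..<max (b i) v}) I"
    using disj unfolding disjoint_family_on_def by blast+
  moreover have "min (a i) v \<le> min (b i) v" "u \<le> min (a i) v" "max (a i) v \<le> max (b i) v" "max (b i) v \<le> w"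
    if "i \<in> I" for i
    using le[OF that] bds[OF that] assms(2,3) by auto
  ultimately show "nonoverlapping I (\<lambda>i. min (a i) v) (\<lambda>i. min (b i) v) {u..v}"
    "nonoverlapping I (\<lambda>i. max (a i) v) (\<lambda>i. max (b i) v) {v..w}"
    using fin unfolding nonoverlapping_def by auto
qed

text \<open>For every \<open>x\<close>, \<open>f (min x v) + f (max x v) = f x + f v\<close>, and
  the terms \<open>f v\<close> cancel in the differences.\<close>

lemma sum_diff_split:
  fixes f :: "real \<Rightarrow> real"
  shows "(\<Sum>i\<in>I. f (b i) - f (a i)) =
    (\<Sum>i\<in>I. f (min (b i) v) - f (min (a i) v)) + (\<Sum>i\<in>I. f (max (b i) v) - f (max (a i) v))"
  unfolding sum.distrib[symmetric] by (rule sum.cong) (auto simp: min_def max_def)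

section \<open>The positive variation of a function\<close>

text \<open>The increments carry their sign and the family need not cover \<open>{u..v}\<close>.
  Intervals with a negative increment can be left out, so the supremum of these sums is the positive
  variation. Index sets in \<open>nat\<close> suffice for finite families.\<close>

definition pos_var_sums :: "(real \<Rightarrow> real) \<Rightarrow> real \<Rightarrow> real \<Rightarrow> real set" where
  "pos_var_sums f u v = {\<Sum>i\<in>I. f (b i) - f (a i) | (I :: nat set) a b. nonoverlapping I a b {u..v}}"

definition pos_var :: "(real \<Rightarrow> real) \<Rightarrow> real \<Rightarrow> real \<Rightarrow> real" where
  "pos_var f u v = Sup (pos_var_sums f u v)"

lemma zero_in_pos_var_sums: "0 \<in> pos_var_sums f u v"
  unfolding pos_var_sums_def nonoverlapping_def disjoint_family_on_def
  by (rule CollectI, rule exI[of _ "{}"]) auto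

definition ac_modulus :: "real set \<Rightarrow> (real \<Rightarrow> real) \<Rightarrow> real \<Rightarrow> real \<Rightarrow> bool" where
  "ac_modulus S f \<epsilon> \<delta> \<longleftrightarrow> (\<forall>D. D division_of \<Union>D \<and> \<Union>D \<subseteq> S \<and> (\<Sum>K\<in>D. Sup K - Inf K) < \<delta> \<longrightarrow>
     (\<Sum>K\<in>D. \<bar>f (Sup K) - f (Inf K)\<bar>) < \<epsilon>)"

lemma abs_continuous_on_iff_modulus:
  "abs_continuous_on S f \<longleftrightarrow> (\<forall>\<epsilon>>0. \<exists>\<delta>>0. ac_modulus S f \<epsilon> \<delta>)"
  unfolding abs_continuous_on_def ac_modulus_def ..

text \<open>Transfers a modulus of absolute continuity from divisions to indexed families, which are
  easier to cut and glue.\<close>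

lemma nonoverlapping_variation_less:
  assumes "ac_modulus S f \<epsilon> \<delta>"
    and I: "nonoverlapping I a b S" and "(\<Sum>i\<in>I. b i - a i) < \<delta>"
  shows "(\<Sum>i\<in>I. f (b i) - f (a i)) < (\<epsilon>::real)"
proof -
  obtain D where D: "D division_of \<Union>D" "\<Union>D \<subseteq> S"
    and eq: "\<And>\<phi>::real \<Rightarrow> real \<Rightarrow> real. (\<And>x. \<phi> x x = 0) \<Longrightarrow> (\<Sum>K\<in>D. \<phi> (Inf K) (Sup K)) = (\<Sum>i\<in>I. \<phi> (a i) (b i))"
    using division_of_nonoverlapping[OF I] by blast
  have "(\<Sum>i\<in>I. f (b i) - f (a i)) \<le> (\<Sum>i\<in>I. \<bar>f (b i) - f (a i)\<bar>)"
    by (rule sum_mono) simp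
  also have "\<dots> = (\<Sum>K\<in>D. \<bar>f (Sup K) - f (Inf K)\<bar>)"
    using eq[of "\<lambda>x y. \<bar>f y - f x\<bar>"] by simp
  also have "\<dots> < \<epsilon>"
    using assms(1,3) D eq[of "\<lambda>x y. y - x"] unfolding ac_modulus_def by simp
  finally show ?thesis .
qed

text \<open>Each piece of length at most \<open>d\<close> has variation below 1. The induction cuts
  one such piece off the right end.\<close>

lemma nonoverlapping_variation_le_steps:
  assumes small: "ac_modulus S f 1 \<delta>" and d: "0 < d" "d < \<delta>"
  shows "nonoverlapping I a b {u..v} \<Longrightarrow> {u..v} \<subseteq> S \<Longrightarrow> u \<le> v \<Longrightarrow> v - u \<le> real (Suc k) * d \<Longrightarrow>
     (\<Sum>i\<in>I. f (b i) - f (a i)) \<le> real (Suc k)"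
proof (induction k arbitrary: a b u v)
  case 0
  then have "(\<Sum>i\<in>I. b i - a i) < \<delta>"
    using nonoverlapping_length_le[OF 0(1)] d by simp
  then show ?case
    using nonoverlapping_variation_less[OF small nonoverlapping_mono[OF 0(1,2)]] by simp
next
  case (Suc k)
  \<comment> \<open>The maximum keeps the cut inside \<open>{u..v}\<close> when that interval is
    shorter than \<open>d\<close>.\<close>
  define c where "c = max u (v - d)"
  have c: "u \<le> c" "c \<le> v" "v - c \<le> d" "c - u \<le> real (Suc k) * d"
    using Suc.prems d unfolding c_def by (auto simp: algebra_simps max_def)
  note sp = nonoverlapping_split[OF Suc.prems(1) c(1,2)]
  have sub: "{u..c} \<subseteq> S" "{c..v} \<subseteq> S" using Suc.prems(2) c by auto
  have "(\<Sum>i\<in>I. f (min (b i) c) - f (min (a i) c)) \<le> real (Suc k)"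
    using Suc.IH[OF sp(1) sub(1) c(1) c(4)] .
  moreover have "(\<Sum>i\<in>I. f (max (b i) c) - f (max (a i) c)) < 1"
    using nonoverlapping_variation_less[OF small nonoverlapping_mono[OF sp(2) sub(2)]]
      nonoverlapping_length_le[OF sp(2) c(2)] c(3) d(2) by linarith
  ultimately show ?case
    unfolding sum_diff_split[of f b a I c] by simp
qed

context
  fixes f :: "real \<Rightarrow> real" and A B :: real
  assumes ac: "abs_continuous_on {A..B} f"
begin

lemma bdd_above_pos_var_sums:
  assumes "A \<le> u" "v \<le> B"
  shows "bdd_above (pos_var_sums f u v)"
proof (cases "u \<le> v")
  case True
  obtain \<delta> where "\<delta> > 0" and \<delta>: "ac_modulus {A..B} f 1 \<delta>"
    using ac zero_less_one unfolding abs_continuous_on_iff_modulus by blast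
  \<comment> \<open>The step length is half of \<open>\<delta>\<close>, since the pieces have to be
    strictly shorter than \<open>\<delta>\<close>.\<close>
  obtain k where "(v - u) / (\<delta>/2) \<le> real k" using real_arch_simple by blast
  then have "v - u \<le> real k * (\<delta>/2)" using \<open>\<delta> > 0\<close> by (simp add: field_simps)
  also have "\<dots> \<le> real (Suc k) * (\<delta>/2)" using \<open>\<delta> > 0\<close> by simp
  finally have k': "v - u \<le> real (Suc k) * (\<delta>/2)" .
  have "(\<Sum>i\<in>I. f (b i) - f (a i)) \<le> real (Suc k)" if "nonoverlapping (I::nat set) a b {u..v}" for I a b
    by (rule nonoverlapping_variation_le_steps[OF \<delta> _ _ that _ True k']) (use \<open>\<delta> > 0\<close> assms in auto)
  then show ?thesis unfolding pos_var_sums_def bdd_above_def by blast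
next
  case False
  have "(\<Sum>i\<in>I. f (b i) - f (a i)) = 0" if "nonoverlapping (I::nat set) a b {u..v}" for I a b
    using that False unfolding nonoverlapping_def by (intro sum.neutral) auto
  then show ?thesis unfolding pos_var_sums_def bdd_above_def by auto
qed

lemma pos_var_upper:
  assumes "A \<le> u" "v \<le> B" "nonoverlapping (I::nat set) a b {u..v}"
  shows "(\<Sum>i\<in>I. f (b i) - f (a i)) \<le> pos_var f u v"
  unfolding pos_var_def
  by (rule cSup_upper[OF _ bdd_above_pos_var_sums[OF assms(1,2)]])
     (use assms(3) in \<open>auto simp: pos_var_sums_def\<close>)

lemma pos_var_least:
  assumes "\<And>(I::nat set) a b. nonoverlapping I a b {u..v} \<Longrightarrow> (\<Sum>i\<in>I. f (b i) - f (a i)) \<le> c"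
  shows "pos_var f u v \<le> c"
  unfolding pos_var_def
proof (rule cSup_least)
  show "pos_var_sums f u v \<noteq> {}" using zero_in_pos_var_sums by blast
qed (use assms in \<open>auto simp: pos_var_sums_def\<close>)

lemma pos_var_mono:
  assumes "A \<le> u" "v \<le> w" "w \<le> B"
  shows "pos_var f u v \<le> pos_var f u w"
proof (rule pos_var_least)
  fix I :: "nat set" and a b assume "nonoverlapping I a b {u..v}"
  then have "nonoverlapping I a b {u..w}" by (rule nonoverlapping_mono) (use assms in auto)
  then show "(\<Sum>i\<in>I. f (b i) - f (a i)) \<le> pos_var f u w" using pos_var_upper assms by simp
qed

text \<open>A family on \<open>{u..w}\<close> is cut at \<open>v\<close>, and each half is bounded
  by the variation on its side.\<close>

lemma pos_var_add_le:
  assumes "A \<le> u" "u \<le> v" "v \<le> w" "w \<le> B"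
  shows "pos_var f u w \<le> pos_var f u v + pos_var f v w"
proof (rule pos_var_least)
  fix I :: "nat set" and a b assume I: "nonoverlapping I a b {u..w}"
  note sp = nonoverlapping_split[OF I assms(2,3)]
  show "(\<Sum>i\<in>I. f (b i) - f (a i)) \<le> pos_var f u v + pos_var f v w"
    unfolding sum_diff_split[of f b a I v]
    using pos_var_upper[OF _ _ sp(1)] pos_var_upper[OF _ _ sp(2)] assms by simp
qed

text \<open>A family on \<open>{u..v}\<close> is extended by the interval from \<open>v\<close> to
  \<open>w\<close>. Consequently \<open>pos_var f A\<close> minus \<open>f\<close> is increasing,
  the second half of the Jordan decomposition.\<close>

lemma pos_var_add_ge:
  assumes "A \<le> u" "u \<le> v" "v \<le> w" "w \<le> B"
  shows "pos_var f u v + (f w - f v) \<le> pos_var f u w"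
proof -
  have "pos_var f u v \<le> pos_var f u w - (f w - f v)"
  proof (rule pos_var_least)
    fix I :: "nat set" and a b assume I: "nonoverlapping I a b {u..v}"
    then have "finite I" unfolding nonoverlapping_def by blast
    \<comment> \<open>A fresh index for the interval that is adjoined.\<close>
    then obtain n where n: "n \<notin> I" using ex_new_if_finite infinite_UNIV_nat by blast
    have le: "\<And>i. i \<in> I \<Longrightarrow> a i \<le> b i" and sub: "\<And>i. i \<in> I \<Longrightarrow> {a i..b i} \<subseteq> {u..v}"
      and disj: "disjoint_family_on (\<lambda>i. {a i<..<b i}) I"
      using I unfolding nonoverlapping_def by blast+
    have bds: "u \<le> a i" "b i \<le> v" if "i \<in> I" for i using le[OF that] sub[OF that] by auto
    have "{a i<..<b i} \<inter> {v<..<w} = {}" if "i \<in> I" for i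
      using bds[OF that] by auto
    then have "{(a(n:=v)) i<..<(b(n:=w)) i} \<inter> {(a(n:=v)) j<..<(b(n:=w)) j} = {}"
      if "i \<in> insert n I" "j \<in> insert n I" "i \<noteq> j" for i j
      using that n disj unfolding disjoint_family_on_def by (cases "i = n"; cases "j = n") (simp_all add: Int_commute)
    moreover have "(a(n:=v)) i \<le> (b(n:=w)) i \<and> u \<le> (a(n:=v)) i \<and> (b(n:=w)) i \<le> w" if "i \<in> insert n I" for i
      using that le[of i] bds[of i] assms by (cases "i = n") auto
    ultimately have "nonoverlapping (insert n I) (a(n:=v)) (b(n:=w)) {u..w}"
      using \<open>finite I\<close> unfolding nonoverlapping_def disjoint_family_on_def atLeastatMost_subset_iff by blast
    from pos_var_upper[OF _ _ this]
    have "(\<Sum>i\<in>insert n I. f ((b(n:=w)) i) - f ((a(n:=v)) i)) \<le> pos_var f u w" using assms by simp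
    also have "(\<Sum>i\<in>insert n I. f ((b(n:=w)) i) - f ((a(n:=v)) i)) = f w - f v + (\<Sum>i\<in>I. f (b i) - f (a i))"
      using n \<open>finite I\<close> by (simp, intro sum.cong) auto
    finally show "(\<Sum>i\<in>I. f (b i) - f (a i)) \<le> pos_var f u w - (f w - f v)" by simp
  qed
  then show ?thesis by simp
qed

lemma pos_var_approx:
  assumes "\<eta> > 0"
  obtains I :: "nat set" and a b where "nonoverlapping I a b {u..v}"
    "pos_var f u v - \<eta> < (\<Sum>i\<in>I. f (b i) - f (a i))"
proof -
  have "\<exists>s\<in>pos_var_sums f u v. pos_var f u v - \<eta> < s"
    unfolding pos_var_def
    by (rule less_cSupD) (use zero_in_pos_var_sums assms in auto)
  then show ?thesis using that unfolding pos_var_sums_def by blast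
qed

text \<open>On each interval of \<open>D\<close> a nearly optimal family is chosen. All of them
  together form one family that is no longer than \<open>D\<close>, so the modulus of
  \<open>f\<close> bounds its variation.\<close>

lemma abs_continuous_on_pos_var: "abs_continuous_on {A..B} (pos_var f A)"
  unfolding abs_continuous_on_iff_modulus
proof (intro allI impI)
  fix \<epsilon> :: real assume "\<epsilon> > 0"
  obtain \<delta> where "\<delta> > 0" and \<delta>: "ac_modulus {A..B} f (\<epsilon>/2) \<delta>"
    using ac half_gt_zero[OF \<open>\<epsilon> > 0\<close>] unfolding abs_continuous_on_iff_modulus by blast
  show "\<exists>\<delta>>0. ac_modulus {A..B} (pos_var f A) \<epsilon> \<delta>"
    unfolding ac_modulus_def
  proof (intro exI[of _ \<delta>] conjI allI impI \<open>\<delta> > 0\<close>)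
    fix D assume D: "D division_of \<Union>D \<and> \<Union>D \<subseteq> {A..B} \<and> (\<Sum>K\<in>D. Sup K - Inf K) < \<delta>"
    then have nD: "nonoverlapping D Inf Sup {A..B}" using nonoverlapping_division by blast
    then have fin: "finite D" and le: "\<And>K. K \<in> D \<Longrightarrow> Inf K \<le> Sup K"
      and sub: "\<And>K. K \<in> D \<Longrightarrow> {Inf K..Sup K} \<subseteq> {A..B}"
      and disj: "\<And>K L. K \<in> D \<Longrightarrow> L \<in> D \<Longrightarrow> K \<noteq> L \<Longrightarrow> {Inf K<..<Sup K} \<inter> {Inf L<..<Sup L} = {}"
      unfolding nonoverlapping_def disjoint_family_on_def by blast+
    have bds: "A \<le> Inf K" "Sup K \<le> B" if "K \<in> D" for K using sub[OF that] le[OF that] by auto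
    \<comment> \<open>The errors \<open>\<eta>\<close> add up to at most half of
      \<open>\<epsilon>\<close>; the added 1 keeps the denominator positive for empty
      \<open>D\<close>.\<close>
    define \<eta> where "\<eta> = \<epsilon> / (2 * (real (card D) + 1))"
    have "\<eta> > 0" using \<open>\<epsilon> > 0\<close> unfolding \<eta>_def by simp
    have "\<exists>I a b. nonoverlapping (I::nat set) a b {Inf K..Sup K} \<and>
        pos_var f (Inf K) (Sup K) - \<eta> < (\<Sum>i\<in>I. f (b i) - f (a i))" for K
      using pos_var_approx[OF \<open>\<eta> > 0\<close>] by metis
    then obtain I a b where I: "\<And>K. nonoverlapping (I K::nat set) (a K) (b K) {Inf K..Sup K}"
      and apx: "\<And>K. pos_var f (Inf K) (Sup K) - \<eta> < (\<Sum>i\<in>I K. f (b K i) - f (a K i))"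
      by metis
    \<comment> \<open>The glued family is indexed by pairs of an interval of \<open>D\<close> and an
      index of its own family.\<close>
    let ?S = "Sigma D I" and ?a = "\<lambda>(K,i). a K i" and ?b = "\<lambda>(K,i). b K i"
    have finI: "finite (I K)" and leI: "\<And>i. i \<in> I K \<Longrightarrow> a K i \<le> b K i"
      and subI: "\<And>i. i \<in> I K \<Longrightarrow> {a K i..b K i} \<subseteq> {Inf K..Sup K}"
      and disjI: "\<And>i j. i \<in> I K \<Longrightarrow> j \<in> I K \<Longrightarrow> i \<noteq> j \<Longrightarrow> {a K i<..<b K i} \<inter> {a K j<..<b K j} = {}" for K
      using I[of K] unfolding nonoverlapping_def disjoint_family_on_def by blast+
    have inK: "{a K i<..<b K i} \<subseteq> {Inf K<..<Sup K}" if "i \<in> I K" for K i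
      using subI[OF that] leI[OF that] by (auto simp: atLeastatMost_subset_iff)
    have "{a K i<..<b K i} \<inter> {a L j<..<b L j} = {}"
      if "K \<in> D" "L \<in> D" "i \<in> I K" "j \<in> I L" "(K,i) \<noteq> (L,j)" for K L i j
    proof (cases "K = L")
      case True
      then show ?thesis using disjI[of i K j] that by simp
    next
      case False
      then show ?thesis using disj[of K L] inK[of i K] inK[of j L] that by blast
    qed
    then have "disjoint_family_on (\<lambda>p. {?a p<..<?b p}) ?S"
      unfolding disjoint_family_on_def by (auto simp: split_beta)
    moreover have "{a K i..b K i} \<subseteq> {A..B}" if "K \<in> D" "i \<in> I K" for K i
      using subI[OF that(2)] sub[OF that(1)] by blast
    ultimately have nS: "nonoverlapping ?S ?a ?b {A..B}"
      unfolding nonoverlapping_def using fin finI leI by auto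
    have sS: "(\<Sum>p\<in>?S. \<phi> (?b p) - \<phi> (?a p)) = (\<Sum>K\<in>D. \<Sum>i\<in>I K. \<phi> (b K i) - \<phi> (a K i))" for \<phi> :: "real \<Rightarrow> real"
      by (subst sum.Sigma) (use fin finI in \<open>auto simp: split_beta\<close>)
    have "(\<Sum>p\<in>?S. ?b p - ?a p) \<le> (\<Sum>K\<in>D. Sup K - Inf K)"
      unfolding sS[of "\<lambda>x. x"] by (intro sum_mono nonoverlapping_length_le I le)
    then have "(\<Sum>p\<in>?S. f (?b p) - f (?a p)) < \<epsilon>/2"
      using nonoverlapping_variation_less[OF \<delta> nS] D by linarith
    then have lt: "(\<Sum>K\<in>D. \<Sum>i\<in>I K. f (b K i) - f (a K i)) < \<epsilon>/2" unfolding sS .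
    have "(\<Sum>K\<in>D. \<bar>pos_var f A (Sup K) - pos_var f A (Inf K)\<bar>) \<le> (\<Sum>K\<in>D. pos_var f (Inf K) (Sup K))"
    proof (rule sum_mono)
      fix K assume K: "K \<in> D"
      show "\<bar>pos_var f A (Sup K) - pos_var f A (Inf K)\<bar> \<le> pos_var f (Inf K) (Sup K)"
        using pos_var_add_le[of A "Inf K" "Sup K"] pos_var_mono[of A "Inf K" "Sup K"] bds[OF K] le[OF K] by simp
    qed
    also have "\<dots> \<le> (\<Sum>K\<in>D. (\<Sum>i\<in>I K. f (b K i) - f (a K i)) + \<eta>)"
      by (rule sum_mono) (use apx in \<open>smt (verit)\<close>)
    also have "\<dots> = (\<Sum>K\<in>D. \<Sum>i\<in>I K. f (b K i) - f (a K i)) + real (card D) * \<eta>"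
      by (simp add: sum.distrib)
    also have "real (card D) * \<eta> \<le> \<epsilon>/2"
      using \<open>\<epsilon> > 0\<close> unfolding \<eta>_def by (simp add: field_simps)
    finally show "(\<Sum>K\<in>D. \<bar>pos_var f A (Sup K) - pos_var f A (Inf K)\<bar>) < \<epsilon>" using lt by linarith
  qed
qed

end

section \<open>Differences and continuity\<close>

lemma abs_continuous_on_diff:
  assumes "abs_continuous_on S f" "abs_continuous_on S g"
  shows "abs_continuous_on S (\<lambda>x. f x - g x)"
  unfolding abs_continuous_on_iff_modulus
proof (intro allI impI)
  fix \<epsilon> :: real assume "\<epsilon> > 0"
  then obtain d1 d2 where d: "d1 > 0" "ac_modulus S f (\<epsilon>/2) d1" "d2 > 0" "ac_modulus S g (\<epsilon>/2) d2"
    using assms unfolding abs_continuous_on_iff_modulus by (meson half_gt_zero)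
  have "(\<Sum>K\<in>D. \<bar>(f (Sup K) - g (Sup K)) - (f (Inf K) - g (Inf K))\<bar>) < \<epsilon>"
    if "D division_of \<Union>D" "\<Union>D \<subseteq> S" "(\<Sum>K\<in>D. Sup K - Inf K) < min d1 d2" for D
  proof -
    have "(\<Sum>K\<in>D. \<bar>(f (Sup K) - g (Sup K)) - (f (Inf K) - g (Inf K))\<bar>)
        \<le> (\<Sum>K\<in>D. \<bar>f (Sup K) - f (Inf K)\<bar> + \<bar>g (Sup K) - g (Inf K)\<bar>)"
      by (rule sum_mono) linarith
    also have "\<dots> = (\<Sum>K\<in>D. \<bar>f (Sup K) - f (Inf K)\<bar>) + (\<Sum>K\<in>D. \<bar>g (Sup K) - g (Inf K)\<bar>)"
      by (rule sum.distrib)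
    also have "\<dots> < \<epsilon>/2 + \<epsilon>/2"
      using d that unfolding ac_modulus_def by (intro add_strict_mono) auto
    finally show ?thesis by simp
  qed
  then show "\<exists>\<delta>>0. ac_modulus S (\<lambda>x. f x - g x) \<epsilon> \<delta>"
    using d unfolding ac_modulus_def by (intro exI[of _ "min d1 d2"]) auto
qed

lemma abs_continuous_on_imp_continuous_on:
  assumes ac: "abs_continuous_on {A..B} f"
  shows "continuous_on {A..B} f"
  unfolding continuous_on_iff
proof (intro ballI allI impI)
  fix x e :: real assume x: "x \<in> {A..B}" and "e > 0"
  then obtain d where d: "d > 0" "ac_modulus {A..B} f e d"
    using ac unfolding abs_continuous_on_iff_modulus by blast
  have "\<bar>f y - f x\<bar> < e" if y: "y \<in> {A..B}" "\<bar>y - x\<bar> < d" for y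
  proof -
    let ?D = "{{min x y..max x y}}"
    have "?D division_of \<Union>?D" using division_of_self[of "min x y" "max x y"] by (simp add: cbox_interval)
    moreover have "\<Union>?D \<subseteq> {A..B}" using x y by auto
    moreover have "(\<Sum>K\<in>?D. Sup K - Inf K) < d"
      using y(2) by (cases "x \<le> y") (simp_all add: max_def min_def)
    ultimately have "(\<Sum>K\<in>?D. \<bar>f (Sup K) - f (Inf K)\<bar>) < e"
      using d(2) unfolding ac_modulus_def by blast
    then show ?thesis by (cases "x \<le> y") (simp_all add: max_def min_def abs_minus_commute)
  qed
  then show "\<exists>d>0. \<forall>x'\<in>{A..B}. dist x' x < d \<longrightarrow> dist (f x') (f x) < e"
    using d(1) by (auto simp: dist_real_def)
qed

section \<open>Densities from the Radon-Nikodym theorem\<close>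

text \<open>\<open>N\<close> lies in an open \<open>U\<close> of small Lebesgue measure and is
  covered by countably many non-overlapping intervals inside \<open>U\<close>. Every finite
  subfamily is short, so \<open>F\<close> increases little on it, and its Stieltjes measure is
  small. Continuity from below extends the bound to the whole cover.\<close>

lemma interval_measure_null_of_abs_continuous:
  fixes F :: "real \<Rightarrow> real"
  assumes mono: "\<And>x y. x \<le> y \<Longrightarrow> F x \<le> F y" and cont: "continuous_on UNIV F"
    and ac: "abs_continuous_on {A..B} F" and "A < B"
    and N: "N \<in> null_sets lborel" "N \<subseteq> {A..B}"
  shows "emeasure (interval_measure F) N = 0"
proof -
  have sets: "sets (interval_measure F) = sets borel" by simp
  have "emeasure (interval_measure F) N \<le> ennreal e" if "e > 0" for e
  proof -
    obtain d where d: "d > 0" "ac_modulus {A..B} F e d"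
      using ac \<open>e > 0\<close> unfolding abs_continuous_on_iff_modulus by blast
    have Nb: "N \<in> sets borel" using N(1) by (auto simp: null_sets_def)
    obtain U where U: "open U" "N \<subseteq> U" "emeasure lborel (U - N) < ennreal (d/2)"
      using outer_regular_lborel[OF Nb half_gt_zero[OF d(1)]] by blast
    \<comment> \<open>The radii define a gauge which forces every interval of the cover into
      \<open>U\<close>, because each one lies in the ball around one of its points in
      \<open>N\<close>.\<close>
    have "\<forall>x. \<exists>r>0. x \<in> N \<longrightarrow> ball x r \<subseteq> U"
      using U by (metis open_contains_ball subsetD zero_less_one)
    then obtain r where r: "\<And>x. r x > 0" "\<And>x. x \<in> N \<Longrightarrow> ball x (r x) \<subseteq> U" by metis
    have gauge: "gauge (\<lambda>x. ball x (r x))" using r(1) by (simp add: gauge_def)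
    have NAB: "N \<subseteq> cbox A B" "box A B \<noteq> {}" using N(2) \<open>A < B\<close> by (auto simp: cbox_interval)
    obtain \<D> where \<D>: "countable \<D>" "\<Union>\<D> \<subseteq> cbox A B"
      "\<And>K. K \<in> \<D> \<Longrightarrow> interior K \<noteq> {} \<and> (\<exists>c d. K = cbox c d)"
      "pairwise (\<lambda>A B. interior A \<inter> interior B = {}) \<D>"
      "\<And>K. K \<in> \<D> \<Longrightarrow> \<exists>x \<in> N \<inter> K. K \<subseteq> ball x (r x)" "N \<subseteq> \<Union>\<D>"
    proof (rule covering_lemma[OF NAB gauge])
      fix \<D> assume \<D>: "countable \<D>" "\<Union>\<D> \<subseteq> cbox A B"
      "\<And>K. K \<in> \<D> \<Longrightarrow> interior K \<noteq> {} \<and> (\<exists>c d. K = cbox c d)"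
      "pairwise (\<lambda>A B. interior A \<inter> interior B = {}) \<D>"
      "\<And>K. K \<in> \<D> \<Longrightarrow> \<exists>x \<in> N \<inter> K. K \<subseteq> ball x (r x)" "N \<subseteq> \<Union>\<D>"
      show thesis by (rule that[OF \<D>])
    qed
    have bound: "emeasure (interval_measure F) (\<Union>D) \<le> ennreal e" if D: "finite D" "D \<subseteq> \<D>" for D
    proof -
      have div: "D division_of \<Union>D"
      proof (rule division_ofI)
        show "K \<noteq> {}" if "K \<in> D" for K using \<D>(3)[of K] that D(2) by auto
        show "\<exists>a b. K = cbox a b" if "K \<in> D" for K using \<D>(3)[of K] that D(2) by auto
        show "interior K1 \<inter> interior K2 = {}" if "K1 \<in> D" "K2 \<in> D" "K1 \<noteq> K2" for K1 K2
          using \<D>(4) that D(2) unfolding pairwise_def by blast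
      qed (use D in auto)
      have sub: "\<Union>D \<subseteq> {A..B}" using \<D>(2) D(2) by (auto simp: cbox_interval)
      note nD = nonoverlapping_division[OF div subset_refl]
      have le: "Inf K \<le> Sup K" if "K \<in> D" for K using nD that unfolding nonoverlapping_def by blast
      have K_eq: "K = {Inf K..Sup K}" if "K \<in> D" for K
      proof -
        have "K \<noteq> {}" "\<exists>a b. K = cbox a b" using division_ofD(3,4)[OF div that] by blast+
        then show ?thesis by (auto simp: cbox_interval)
      qed
      have "ennreal (\<Sum>K\<in>D. Sup K - Inf K) = (\<Sum>K\<in>D. emeasure lborel {Inf K<..<Sup K})"
        using le by (subst sum_ennreal[symmetric]) (auto intro!: sum.cong)
      also have "\<dots> = emeasure lborel (\<Union>K\<in>D. {Inf K<..<Sup K})"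
        by (rule sum_emeasure) (use nD in \<open>auto simp: nonoverlapping_def\<close>)
      also have "\<dots> \<le> emeasure lborel U"
      proof (rule emeasure_mono)
        have "{Inf K<..<Sup K} \<subseteq> U" if "K \<in> D" for K
        proof -
          have "{Inf K<..<Sup K} \<subseteq> K" using K_eq[OF that] by (metis greaterThanLessThan_subseteq_atLeastAtMost_iff order_refl)
          also have "K \<subseteq> U" using \<D>(5)[of K] r(2) that D(2) by blast
          finally show ?thesis .
        qed
        then show "(\<Union>K\<in>D. {Inf K<..<Sup K}) \<subseteq> U" by blast
      qed (use U(1) in auto)
      also have "\<dots> \<le> emeasure lborel (U - N) + emeasure lborel N"
        using emeasure_subadditive[of "U - N" lborel N] U(1,2) Nb by (simp add: Un_absorb2)
      also have "\<dots> \<le> ennreal (d/2)" using U(3) N(1) by (simp add: null_sets_def)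
      also have "\<dots> < ennreal d" using d(1) by (simp add: ennreal_lessI)
      finally have "(\<Sum>K\<in>D. Sup K - Inf K) < d" using d(1) by (simp add: ennreal_less_iff sum_nonneg le)
      then have lt: "(\<Sum>K\<in>D. \<bar>F (Sup K) - F (Inf K)\<bar>) < e"
        using d(2) div sub unfolding ac_modulus_def by blast
      have "emeasure (interval_measure F) (\<Union>D) \<le> (\<Sum>K\<in>D. emeasure (interval_measure F) K)"
      proof -
        have "emeasure (interval_measure F) (\<Union>K\<in>D. K) \<le> (\<Sum>K\<in>D. emeasure (interval_measure F) K)"
          by (rule emeasure_subadditive_finite) (use D(1) K_eq in \<open>auto, metis atLeastAtMost_borel\<close>)
        then show ?thesis by simp
      qed
      also have "\<dots> = (\<Sum>K\<in>D. ennreal (\<bar>F (Sup K) - F (Inf K)\<bar>))"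
      proof (rule sum.cong[OF refl])
        \<comment> \<open>Continuity of \<open>F\<close> rules out atoms, so a closed interval has
          exactly the increment of \<open>F\<close> as its measure.\<close>
        fix K assume K: "K \<in> D"
        have "emeasure (interval_measure F) {Inf K..Sup K} = ennreal (\<bar>F (Sup K) - F (Inf K)\<bar>)"
          using emeasure_interval_measure_Icc[OF le[OF K] mono cont] mono[OF le[OF K]] by simp
        then show "emeasure (interval_measure F) K = ennreal (\<bar>F (Sup K) - F (Inf K)\<bar>)"
          using K_eq[OF K] by simp
      qed
      also have "\<dots> = ennreal (\<Sum>K\<in>D. \<bar>F (Sup K) - F (Inf K)\<bar>)" by (rule sum_ennreal) simp
      also have "\<dots> \<le> ennreal e" using lt by (simp add: ennreal_leI)
      finally show ?thesis .
    qed
    show ?thesis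
    proof (cases "\<D> = {}")
      case True
      then show ?thesis using \<D>(6) by simp
    next
      case False
      \<comment> \<open>Unions of initial pieces of an enumeration of the cover, possibly with
        repetitions; they increase to the union of the cover.\<close>
      let ?E = "\<lambda>n. \<Union>(from_nat_into \<D> ` {..<n})"
      have mem: "K \<in> sets borel" if "K \<in> \<D>" for K using \<D>(3)[OF that] by auto
      have rng: "from_nat_into \<D> ` {..<n} \<subseteq> \<D>" for n using from_nat_into[OF False] by blast
      have "range ?E \<subseteq> sets (interval_measure F)"
        using mem rng by (auto intro!: sets.finite_Union) 
      moreover have "incseq ?E" by (rule monoI) (meson Union_mono image_mono lessThan_subset_iff)
      ultimately have "(SUP n. emeasure (interval_measure F) (?E n)) = emeasure (interval_measure F) (\<Union>n. ?E n)"
        by (rule SUP_emeasure_incseq)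
      moreover have "(\<Union>n. ?E n) = \<Union>\<D>"
      proof -
        have "(\<Union>n. ?E n) = \<Union>(range (from_nat_into \<D>))" by auto
        then show ?thesis using range_from_nat_into[OF False \<D>(1)] by simp
      qed
      moreover have "(SUP n. emeasure (interval_measure F) (?E n)) \<le> ennreal e"
        by (intro SUP_least bound rng) simp
      moreover have "emeasure (interval_measure F) N \<le> emeasure (interval_measure F) (\<Union>\<D>)"
        by (rule emeasure_mono[OF \<D>(6)]) (use mem \<D>(1) in \<open>auto intro!: sets.countable_Union\<close>)
      ultimately show ?thesis by simp
    qed
  qed
  then have "emeasure (interval_measure F) N \<le> 0 + ennreal e" if "e > 0" for e using that by simp
  then have "emeasure (interval_measure F) N \<le> 0" by (rule ennreal_le_epsilon)
  then show ?thesis by simp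
qed

text \<open>The Stieltjes measure of \<open>f\<close> on \<open>{A..B}\<close> is absolutely
  continuous, and its Radon-Nikodym derivative integrates to the increments of
  \<open>f\<close>.\<close>

lemma mono_abs_continuous_density:
  assumes mono: "\<And>x y. A \<le> x \<Longrightarrow> x \<le> y \<Longrightarrow> y \<le> B \<Longrightarrow> f x \<le> f y"
    and ac: "abs_continuous_on {A..B} f" and "A < B"
  shows "\<exists>h. set_integrable lborel {A..B} h \<and>
    (\<forall>z\<in>{A..B}. f z - f A = (LINT x:{A..z}|lborel. h x))"
proof -
  \<comment> \<open>The constant extension beyond both end points is monotone and continuous on the
    whole line, as \<open>interval_measure\<close> requires.\<close>
  define F where "F x = f (max A (min B x))" for x
  have F_mono: "F x \<le> F y" if "x \<le> y" for x y
    unfolding F_def by (rule mono) (use \<open>A < B\<close> that in auto)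
  have F_eq: "F x = f x" if "x \<in> {A..B}" for x
  proof -
    have "max A (min B x) = x" using that by auto
    then show ?thesis unfolding F_def by simp
  qed
  have "continuous_on UNIV (\<lambda>x. max A (min B x))" by (intro continuous_intros)
  moreover have "(\<lambda>x. max A (min B x)) ` UNIV \<subseteq> {A..B}" using \<open>A < B\<close> by auto
  ultimately have F_cont: "continuous_on UNIV F"
    unfolding F_def using continuous_on_compose2[OF abs_continuous_on_imp_continuous_on[OF ac]] by blast
  have F_ac: "abs_continuous_on {A..B} F"
    unfolding abs_continuous_on_iff_modulus
  proof (intro allI impI)
    fix \<epsilon> :: real assume "\<epsilon> > 0"
    then obtain d where d: "d > 0" "ac_modulus {A..B} f \<epsilon> d"
      using ac unfolding abs_continuous_on_iff_modulus by blast
    have "(\<Sum>K\<in>D. \<bar>F (Sup K) - F (Inf K)\<bar>) = (\<Sum>K\<in>D. \<bar>f (Sup K) - f (Inf K)\<bar>)"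
      if D: "D division_of \<Union>D" "\<Union>D \<subseteq> {A..B}" for D
    proof (rule sum.cong[OF refl])
      fix K assume "K \<in> D"
      then have "Inf K \<le> Sup K" "{Inf K..Sup K} \<subseteq> {A..B}"
        using nonoverlapping_division[OF D] unfolding nonoverlapping_def by blast+
      then show "\<bar>F (Sup K) - F (Inf K)\<bar> = \<bar>f (Sup K) - f (Inf K)\<bar>"
        using F_eq by auto
    qed
    then have "ac_modulus {A..B} F \<epsilon> d" using d(2) unfolding ac_modulus_def by simp
    with d(1) show "\<exists>d>0. ac_modulus {A..B} F \<epsilon> d" by blast
  qed
  define M where "M = density (interval_measure F) (indicator {A..B})"
  have M_emeasure: "emeasure M S = emeasure (interval_measure F) (S \<inter> {A..B})" if "S \<in> sets borel" for S
    unfolding M_def using that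
    by (subst emeasure_density) (auto simp: Int_commute indicator_inter_arith[symmetric] intro!: nn_integral_indicator)
  have "absolutely_continuous lborel M"
    unfolding absolutely_continuous_def
  proof
    fix N :: "real set" assume N: "N \<in> null_sets lborel"
    then have [measurable]: "N \<in> sets borel" by (auto simp: null_sets_def)
    have "N \<inter> {A..B} \<in> null_sets lborel" using N by (intro null_set_Int2) auto
    then have "emeasure (interval_measure F) (N \<inter> {A..B}) = 0"
      by (intro interval_measure_null_of_abs_continuous[OF F_mono F_cont F_ac \<open>A < B\<close>]) auto
    then show "N \<in> null_sets M" by (auto simp: null_sets_def M_emeasure) (simp add: M_def)
  qed
  then obtain g where g [measurable]: "g \<in> borel_measurable lborel" and gM: "density lborel g = M"
    using sigma_finite_measure.Radon_Nikodym[OF lborel.sigma_finite_measure_axioms, of M] by (auto simp: M_def)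
  have nn: "(\<integral>\<^sup>+x\<in>{A..z}. g x \<partial>lborel) = ennreal (f z - f A)" if "z \<in> {A..B}" for z
  proof -
    have "(\<integral>\<^sup>+x\<in>{A..z}. g x \<partial>lborel) = emeasure M {A..z}"
      unfolding gM[symmetric] by (subst emeasure_density) auto
    also have "\<dots> = emeasure (interval_measure F) {A..z}"
      using that by (simp add: M_emeasure Int_absorb2)
    also have "\<dots> = ennreal (F z - F A)"
      using that by (intro emeasure_interval_measure_Icc F_mono F_cont) auto
    finally show ?thesis using F_eq[of z] F_eq[of A] that \<open>A < B\<close> by simp
  qed
  \<comment> \<open>The Radon-Nikodym derivative takes values in \<open>ennreal\<close>. Its
    integral over \<open>{A..B}\<close> is finite, so it is finite almost everywhere there and
    \<open>enn2real\<close> changes no integral.\<close>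
  have fin: "AE x in lborel. x \<in> {A..B} \<longrightarrow> g x \<noteq> \<infinity>"
  proof -
    have "AE x in lborel. g x * indicator {A..B} x \<noteq> \<infinity>"
      by (rule nn_integral_PInf_AE) (use nn[of B] \<open>A < B\<close> in auto)
    then show ?thesis by eventually_elim (auto split: split_indicator_asm)
  qed
  define h where "h x = enn2real (g x)" for x
  have h_nn: "(\<integral>\<^sup>+x. ennreal (indicator {A..z} x *\<^sub>R h x) \<partial>lborel) = ennreal (f z - f A)" if z: "z \<in> {A..B}" for z
  proof -
    have "(\<integral>\<^sup>+x. ennreal (indicator {A..z} x *\<^sub>R h x) \<partial>lborel) = (\<integral>\<^sup>+x\<in>{A..z}. g x \<partial>lborel)"
    proof (rule nn_integral_cong_AE)
      show "AE x in lborel. ennreal (indicator {A..z} x *\<^sub>R h x) = g x * indicator {A..z} x"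
        using fin by eventually_elim (use z in \<open>auto simp: h_def indicator_def less_top\<close>)
    qed
    then show ?thesis using nn[OF z] by simp
  qed
  have hi: "has_bochner_integral lborel (\<lambda>x. indicator {A..z} x *\<^sub>R h x) (f z - f A)" if z: "z \<in> {A..B}" for z
    by (rule has_bochner_integral_nn_integral) (use h_nn[OF z] mono[of A z] z in \<open>auto simp: h_def\<close>)
  show ?thesis
  proof (intro exI[of _ h] conjI ballI)
    show "set_integrable lborel {A..B} h"
      using hi[of B] \<open>A < B\<close> unfolding set_integrable_def by (auto simp: has_bochner_integral_iff)
    show "f z - f A = (LINT x:{A..z}|lborel. h x)" if "z \<in> {A..B}" for z
      using hi[OF that] unfolding set_lebesgue_integral_def by (auto simp: has_bochner_integral_iff)
  qed
qed

text \<open>Jordan decomposition: \<open>f\<close> is the positive variation \<open>?P\<close> minus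
  \<open>?P - f\<close>, and both are increasing and absolutely continuous.\<close>

theorem abs_continuous_density:
  assumes ac: "abs_continuous_on {A..B} f" and "A < B"
  shows "\<exists>h. set_integrable lborel {A..B} h \<and>
    (\<forall>z\<in>{A..B}. f z - f A = (LINT x:{A..z}|lborel. h x))"
proof -
  let ?P = "pos_var f A"
  have "?P x \<le> ?P y" if "A \<le> x" "x \<le> y" "y \<le> B" for x y
    using pos_var_mono[OF ac, of A x y] that by simp
  from mono_abs_continuous_density[OF this abs_continuous_on_pos_var[OF ac] \<open>A < B\<close>]
  obtain h1 where h1: "set_integrable lborel {A..B} h1"
    "\<And>z. z \<in> {A..B} \<Longrightarrow> ?P z - ?P A = (LINT x:{A..z}|lborel. h1 x)"
    by blast
  have "?P x - f x \<le> ?P y - f y" if "A \<le> x" "x \<le> y" "y \<le> B" for x y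
    using pos_var_add_ge[OF ac, of A x y] that by simp
  from mono_abs_continuous_density[OF this abs_continuous_on_diff[OF abs_continuous_on_pos_var[OF ac] ac] \<open>A < B\<close>]
  obtain h2 where h2: "set_integrable lborel {A..B} h2"
    "\<And>z. z \<in> {A..B} \<Longrightarrow> (?P z - f z) - (?P A - f A) = (LINT x:{A..z}|lborel. h2 x)"
    by blast
  show ?thesis
  proof (intro exI[of _ "\<lambda>x. h1 x - h2 x"] conjI ballI)
    show "set_integrable lborel {A..B} (\<lambda>x. h1 x - h2 x)" using h1(1) h2(1) by (rule set_integral_diff)
    fix z assume z: "z \<in> {A..B}"
    have "set_integrable lborel {A..z} h1" "set_integrable lborel {A..z} h2"
      using set_integrable_subset[OF h1(1), of "{A..z}"] set_integrable_subset[OF h2(1), of "{A..z}"] z by auto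
    then have "(LINT x:{A..z}|lborel. h1 x - h2 x) = (LINT x:{A..z}|lborel. h1 x) - (LINT x:{A..z}|lborel. h2 x)"
      by (rule set_integral_diff)
    then show "f z - f A = (LINT x:{A..z}|lborel. h1 x - h2 x)" using h1(2)[OF z] h2(2)[OF z] by simp
  qed
qed

section \<open>Second derivatives and cubic splines\<close>

text \<open>The positive and the negative part of \<open>k\<close>, extended by zero, are densities
  of two finite measures with the same distribution function. The measures are then equal, and so
  are the densities almost everywhere.\<close>

lemma AE_zero_of_interval_integrals_zero:
  fixes k :: "real \<Rightarrow> real"
  assumes int: "set_integrable lborel {A..B} k" and "A < B"
    and zero: "\<And>z. z \<in> {A..B} \<Longrightarrow> (LINT x:{A..z}|lborel. k x) = 0"
  shows "AE x in lborel. x \<in> {A..B} \<longrightarrow> k x = 0"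
proof -
  define K where "K x = indicator {A..B} x * k x" for x
  have K: "integrable lborel K" using int unfolding set_integrable_def K_def by simp
  then have [measurable]: "K \<in> borel_measurable lborel" by auto
  have K_le: "(\<integral>x. indicator {..z} x * K x \<partial>lborel) = 0" for z
  proof (cases "z < A")
    case True
    then have "(\<lambda>x. indicator {..z} x * K x) = (\<lambda>_. 0)" unfolding K_def by (auto simp: indicator_def fun_eq_iff)
    then show ?thesis by (simp only: integral_zero)
  next
    case False
    \<comment> \<open>To the right of \<open>B\<close> the integral keeps its value at
      \<open>B\<close>, hence the minimum.\<close>
    have "indicator {..z} x * K x = indicator {A..min z B} x *\<^sub>R k x" for x
      unfolding K_def by (auto simp: indicator_def)
    then show ?thesis
      using zero[of "min z B"] False \<open>A < B\<close> unfolding set_lebesgue_integral_def by simp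
  qed
  have int_K: "integrable lborel (\<lambda>x. indicator {..z} x * K x)" for z
    using integrable_mult_indicator[OF _ K, of "{..z}"] by simp
  \<comment> \<open>Since \<open>ennreal\<close> sends negative numbers to 0, \<open>M 1\<close> has
    the positive part of \<open>K\<close> as density and \<open>M (-1)\<close> the negative
    part.\<close>
  define M where "M \<sigma> = density lborel (\<lambda>x. ennreal (\<sigma> * K x))" for \<sigma> :: real
  have M_emeasure: "emeasure (M \<sigma>) S = (\<integral>\<^sup>+x. ennreal (\<sigma> * (indicator S x * K x)) \<partial>lborel)"
    if [measurable]: "S \<in> sets borel" for S \<sigma>
    unfolding M_def by (subst emeasure_density) (auto intro!: nn_integral_cong simp: indicator_def)
  have fin: "(\<integral>\<^sup>+x. ennreal (\<sigma> * K x) \<partial>lborel) < \<infinity>" for \<sigma>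
  proof -
    have "integrable lborel (\<lambda>x. \<sigma> * K x)" using K by simp
    then have "(\<integral>\<^sup>+x. ennreal (norm (\<sigma> * K x)) \<partial>lborel) < \<infinity>" unfolding integrable_iff_bounded by blast
    moreover have "(\<integral>\<^sup>+x. ennreal (\<sigma> * K x) \<partial>lborel) \<le> (\<integral>\<^sup>+x. ennreal (norm (\<sigma> * K x)) \<partial>lborel)"
      by (intro nn_integral_mono ennreal_leI) simp
    ultimately show ?thesis by simp
  qed
  have finM: "finite_borel_measure (M \<sigma>)" for \<sigma>
  proof (intro finite_borel_measure.intro finite_borel_measure_axioms.intro finite_measureI)
    show "emeasure (M \<sigma>) (space (M \<sigma>)) \<noteq> \<infinity>"
      using fin[of \<sigma>] M_emeasure[of UNIV \<sigma>] by (simp add: M_def)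
  qed (simp_all add: M_def)
  have "cdf (M 1) z = cdf (M (-1)) z" for z
  proof -
    have "(\<integral>x. indicator {..z} x * K x \<partial>lborel) = measure (M 1) {..z} - measure (M (-1)) {..z}"
      unfolding real_lebesgue_integral_def[OF int_K] measure_def by (simp add: M_emeasure)
    then show ?thesis using K_le[of z] unfolding cdf_def by simp
  qed
  then have "M 1 = M (-1)" using cdf_unique'[OF finM finM] by blast
  then have "AE x in lborel. ennreal (1 * K x) = ennreal (-1 * K x)"
    unfolding M_def using fin[of 1] by (subst (asm) finite_density_unique) auto
  \<comment> \<open>At most one of the two parts is nonzero at a point, so their equality makes both
    vanish.\<close>
  then show ?thesis
    by eventually_elim (auto simp: K_def ennreal_eq_0_iff split: split_indicator_asm, smt (verit) ennreal_eq_0_iff ennreal_0)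
qed

text \<open>The property under the choice operator of \<open>second_deriv01\<close>, stated for any
  \<open>h\<close>, so that the chosen density can be compared with an explicit one.\<close>

definition is_second_deriv :: "(real \<Rightarrow> real) \<Rightarrow> (real \<Rightarrow> real) \<Rightarrow> bool" where
  "is_second_deriv g h \<longleftrightarrow> set_integrable lborel {0..1} h \<and>
     (\<forall>z\<in>{0..1}. deriv01 g z - deriv01 g 0 = (LINT x:{0..z}|lborel. h x))"

lemma second_deriv01_works:
  assumes "g \<in> smooth_class"
  shows "is_second_deriv g (second_deriv01 g)"
proof -
  have "\<exists>h. is_second_deriv g h"
    using abs_continuous_density[of 0 1 "deriv01 g"] assms unfolding smooth_class_def is_second_deriv_def by auto
  then show ?thesis
    unfolding second_deriv01_def is_second_deriv_def by (rule someI_ex)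
qed

lemma is_second_deriv_unique:
  assumes "is_second_deriv g h" "is_second_deriv g k"
  shows "AE x in lborel. x \<in> {0..1} \<longrightarrow> h x = k x"
proof -
  have ih: "set_integrable lborel {0..1} h" and ik: "set_integrable lborel {0..1} k"
    using assms unfolding is_second_deriv_def by auto
  have "AE x in lborel. x \<in> {0..1} \<longrightarrow> h x - k x = 0"
  proof (rule AE_zero_of_interval_integrals_zero)
    show "set_integrable lborel {0..1} (\<lambda>x. h x - k x)" by (rule set_integral_diff[OF ih ik])
    fix z :: real assume z: "z \<in> {0..1}"
    then have "set_integrable lborel {0..z} h" "set_integrable lborel {0..z} k"
      using set_integrable_subset[OF ih, of "{0..z}"] set_integrable_subset[OF ik, of "{0..z}"] by auto
    then have "(LINT x:{0..z}|lborel. h x - k x) = (LINT x:{0..z}|lborel. h x) - (LINT x:{0..z}|lborel. k x)"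
      by (rule set_integral_diff)
    then show "(LINT x:{0..z}|lborel. h x - k x) = 0"
      using assms z unfolding is_second_deriv_def by auto
  qed simp
  then show ?thesis by eventually_elim auto
qed

section \<open>Taylor's formula with integral remainder\<close>

text \<open>Fubini on the triangle \<open>0 \<le> z \<le> y \<le> x\<close>: for fixed
  \<open>z\<close> the variable \<open>y\<close> runs over a set of length
  \<open>max 0 (x - z)\<close>.\<close>

lemma iterated_integral_eq:
  fixes h :: "real \<Rightarrow> real"
  assumes h: "set_integrable lborel {0..1} h" and x: "x \<in> {0..1}"
  shows "(LINT y:{0..x}|lborel. (LINT z:{0..y}|lborel. h z)) = (LINT z:{0..1}|lborel. max 0 (x - z) * h z)"
proof -
  define H where "H z = indicator {0..1} z * h z" for z
  have H: "integrable lborel H" using h unfolding set_integrable_def H_def by simp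
  then have H_meas: "H \<in> borel_measurable lborel" by auto
  have [measurable]: "(\<lambda>p. H (snd p)) \<in> borel_measurable (lborel \<Otimes>\<^sub>M lborel)"
    by (rule measurable_compose[OF measurable_snd H_meas])
  \<comment> \<open>The integrand on the triangle, extended by zero to the plane.\<close>
  define \<phi> where "\<phi> y z = indicator {0..x} y * (if z \<le> y then H z else 0)" for y z :: real
  have in1: "integrable lborel (\<lambda>z. \<phi> y z)" for y
  proof -
    have "\<phi> y z = indicator {0..x} y * (indicator {..y} z *\<^sub>R H z)" for z
      unfolding \<phi>_def by (simp add: indicator_def)
    then show ?thesis using integrable_mult_indicator[OF _ H, of "{..y}"] by simp
  qed
  have nb: "(\<integral>z. norm (\<phi> y z) \<partial>lborel) \<le> indicator {0..x} y * (\<integral>z. norm (H z) \<partial>lborel)" for y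
  proof -
    have "(\<integral>z. norm (\<phi> y z) \<partial>lborel) \<le> (\<integral>z. indicator {0..x} y * norm (H z) \<partial>lborel)"
      by (rule integral_mono) (use in1 H in \<open>auto simp: \<phi>_def indicator_def\<close>)
    then show ?thesis by simp
  qed
  have "integrable (lborel \<Otimes>\<^sub>M lborel) (\<lambda>(y,z). \<phi> y z)"
  proof (rule lborel_pair.Fubini_integrable)
    show "(\<lambda>(y,z). \<phi> y z) \<in> borel_measurable (lborel \<Otimes>\<^sub>M lborel)"
      unfolding \<phi>_def split_beta by measurable
    then have m: "(\<lambda>y. \<integral>z. norm (\<phi> y z) \<partial>lborel) \<in> borel_measurable lborel"
      by measurable
    show "integrable lborel (\<lambda>y. \<integral>z. norm (case (y, z) of (y, z) \<Rightarrow> \<phi> y z) \<partial>lborel)"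
    proof (rule Bochner_Integration.integrable_bound[of lborel "\<lambda>y. indicator {0..x} y * (\<integral>z. norm (H z) \<partial>lborel)"])
      show "integrable lborel (\<lambda>y. indicator {0..x} y * (\<integral>z. norm (H z) \<partial>lborel))"
        by (intro integrable_mult_left integrable_real_indicator) (use x in auto)
      show "AE y in lborel. norm (\<integral>z. norm (case (y, z) of (y, z) \<Rightarrow> \<phi> y z) \<partial>lborel)
          \<le> norm (indicator {0..x} y * (\<integral>z. norm (H z) \<partial>lborel))"
        using nb by (intro AE_I2) (auto simp: integral_nonneg_AE intro: order.trans[OF _ abs_ge_self])
    qed (use m in simp)
    show "AE y in lborel. integrable lborel (\<lambda>z. case (y, z) of (y, z) \<Rightarrow> \<phi> y z)"
      using in1 by simp
  qed
  then have "(\<integral>z. (\<integral>y. \<phi> y z \<partial>lborel) \<partial>lborel) = (\<integral>y. (\<integral>z. \<phi> y z \<partial>lborel) \<partial>lborel)"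
    by (rule lborel_pair.Fubini_integral)
  moreover have "(\<integral>z. \<phi> y z \<partial>lborel) = indicator {0..x} y *\<^sub>R (LINT z:{0..y}|lborel. h z)" for y
  proof -
    have "\<phi> y z = indicator {0..x} y * (indicator {0..y} z *\<^sub>R h z)" for z
      using x unfolding \<phi>_def H_def by (auto simp: indicator_def)
    then show ?thesis unfolding set_lebesgue_integral_def by simp
  qed
  moreover have "(\<integral>y. \<phi> y z \<partial>lborel) = indicator {0..1} z *\<^sub>R (max 0 (x - z) * h z)" for z
  proof (cases "z \<in> {0..1}")
    case True
    have "\<phi> y z = indicator {z..x} y * h z" for y
      using True unfolding \<phi>_def H_def by (auto simp: indicator_def)
    then show ?thesis using True by (simp add: max_def)
  next
    case False
    then have "(\<lambda>y. \<phi> y z) = (\<lambda>_. 0)" unfolding \<phi>_def H_def by (simp add: fun_eq_iff)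
    then show ?thesis using False by simp
  qed
  ultimately show ?thesis unfolding set_lebesgue_integral_def by simp
qed

text \<open>The fundamental theorem applies to \<open>g\<close> because its derivative is
  continuous; writing that derivative as its value at 0 plus the integral of \<open>h\<close>
  produces the iterated integral.\<close>

lemma smooth_class_taylor:
  assumes g: "g \<in> smooth_class" and h: "is_second_deriv g h" and x: "x \<in> {0..1}"
  shows "g x = g 0 + deriv01 g 0 * x + (LINT z:{0..1}|lborel. max 0 (x - z) * h z)"
proof -
  have dg: "(g has_vector_derivative deriv01 g y) (at y within {0..x})" if "0 \<le> y" "y \<le> x" for y
  proof -
    have "g differentiable (at y within {0..1})"
      using g that x unfolding smooth_class_def differentiable_on_def by auto
    then have "(g has_vector_derivative deriv01 g y) (at y within {0..1})"
      unfolding deriv01_def by (simp add: vector_derivative_works)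
    then show ?thesis by (rule has_vector_derivative_within_subset) (use x in auto)
  qed
  have cont: "continuous_on {0..x} (deriv01 g)"
    using abs_continuous_on_imp_continuous_on[of 0 1 "deriv01 g"] g x
    unfolding smooth_class_def by (auto intro: continuous_on_subset)
  have ch: "continuous_on {0..x} (\<lambda>y. deriv01 g y - deriv01 g 0)" using cont by (intro continuous_intros)
  have si: "set_integrable lborel {0..x} (\<lambda>y. deriv01 g y - deriv01 g 0)"
    using borel_integrable_compact[OF compact_Icc ch] unfolding set_integrable_def by simp
  have "g x - g 0 = (LINT y:{0..x}|lborel. deriv01 g y)"
    using integral_FTC_Icc[of 0 x g "deriv01 g"] dg cont x unfolding set_lebesgue_integral_def by simp
  also have "\<dots> = (LINT y:{0..x}|lborel. deriv01 g 0 + (deriv01 g y - deriv01 g 0))" by simp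
  also have "\<dots> = (LINT y:{0..x}|lborel. deriv01 g 0) + (LINT y:{0..x}|lborel. deriv01 g y - deriv01 g 0)"
    by (rule set_integral_add(2)[OF _ si])
      (use x in \<open>simp add: set_integrable_def integrable_real_indicator[of "{0..x}" lborel]\<close>)
  also have "(LINT y:{0..x}|lborel. deriv01 g 0) = deriv01 g 0 * x"
    using x unfolding set_lebesgue_integral_def by simp
  also have "(LINT y:{0..x}|lborel. deriv01 g y - deriv01 g 0) = (LINT y:{0..x}|lborel. (LINT z:{0..y}|lborel. h z))"
    by (rule set_lebesgue_integral_cong) (use h x in \<open>auto simp: is_second_deriv_def\<close>)
  also have "\<dots> = (LINT z:{0..1}|lborel. max 0 (x - z) * h z)"
    using h x unfolding is_second_deriv_def by (intro iterated_integral_eq) auto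
  finally show ?thesis by simp
qed

section \<open>The cubic form and its derivatives\<close>

text \<open>Away from 0 the function is plus or minus a square; at 0 its difference quotient is
  \<open>\<bar>h\<bar>\<close>.\<close>

lemma has_real_derivative_mult_abs: "((\<lambda>x. x * \<bar>x\<bar>) has_real_derivative 2 * \<bar>x\<bar>) (at (x::real))"
proof (cases x "0::real" rule: linorder_cases)
  case less
  have "((\<lambda>x. - (x * x)) has_real_derivative 2 * \<bar>x\<bar>) (at x)"
    using less by (auto intro!: derivative_eq_intros)
  then show ?thesis
    by (rule has_field_derivative_transform_within_open[where S = "{..<0}"]) (use less in auto)
next
  case greater
  have "((\<lambda>x. x * x) has_real_derivative 2 * \<bar>x\<bar>) (at x)"
    using greater by (auto intro!: derivative_eq_intros)
  then show ?thesis
    by (rule has_field_derivative_transform_within_open[where S = "{0<..}"]) (use greater in auto)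
next
  case equal
  have "((\<lambda>h::real. \<bar>h\<bar>) \<longlongrightarrow> 0) (at 0)" by (auto intro!: tendsto_eq_intros)
  then have "((\<lambda>h::real. (h * \<bar>h\<bar> - 0 * \<bar>0\<bar>) / (h - 0)) \<longlongrightarrow> 0) (at 0)"
    by (rule Lim_transform_eventually) (auto simp: eventually_at_filter)
  then show ?thesis unfolding equal has_field_derivative_iff by simp
qed

lemma has_real_derivative_diff_mult_abs:
  "((\<lambda>z. (z - c) * \<bar>z - c\<bar>) has_real_derivative 2 * \<bar>z - c\<bar>) (at (z::real))"
proof -
  have "((\<lambda>z. z - c) has_real_derivative 1) (at z)" by (auto intro!: derivative_eq_intros)
  from DERIV_chain2[where f = "\<lambda>x. x * \<bar>x\<bar>" and g = "\<lambda>z. z - c", OF has_real_derivative_mult_abs this]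
  show ?thesis by simp
qed

definition cubic_form_deriv :: "real^'n \<Rightarrow> real \<Rightarrow> real^'n \<Rightarrow> real \<Rightarrow> real" where
  "cubic_form_deriv Z a\<^sub>1 \<delta> z = a\<^sub>1 + 1/4 * (\<Sum>i\<in>UNIV. \<delta> $ i * ((z - Z $ i) * \<bar>z - Z $ i\<bar>))"

definition cubic_form_deriv2 :: "real^'n \<Rightarrow> real^'n \<Rightarrow> real \<Rightarrow> real" where
  "cubic_form_deriv2 Z \<delta> z = 1/2 * (\<Sum>i\<in>UNIV. \<delta> $ i * \<bar>z - Z $ i\<bar>)"

lemma cubic_form_has_derivative:
  "(cubic_form Z a\<^sub>0 a\<^sub>1 \<delta> has_real_derivative cubic_form_deriv Z a\<^sub>1 \<delta> z) (at z)"
proof -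
  \<comment> \<open>In this form the product rule differentiates the cube at the knot
    \<open>c\<close> as well.\<close>
  have eq: "\<bar>z - c\<bar> ^ 3 = (z - c) * ((z - c) * \<bar>z - c\<bar>)" for z c :: real
    by (simp add: power3_eq_cube abs_mult_self_eq mult.assoc[symmetric])
  have "cubic_form Z a\<^sub>0 a\<^sub>1 \<delta> = (\<lambda>z. a\<^sub>0 + a\<^sub>1 * z + 1/12 * (\<Sum>i\<in>UNIV. \<delta> $ i * ((z - Z $ i) * ((z - Z $ i) * \<bar>z - Z $ i\<bar>))))"
    unfolding cubic_form_def eq ..
  moreover have "((\<lambda>z. (z - c) * ((z - c) * \<bar>z - c\<bar>)) has_real_derivative 3 * ((z - c) * \<bar>z - c\<bar>)) (at z)" for c
    using DERIV_mult[OF DERIV_diff[OF DERIV_ident DERIV_const] has_real_derivative_diff_mult_abs[of c z], of c]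
    by simp
  then have "((\<lambda>z. \<Sum>i\<in>UNIV. \<delta> $ i * ((z - Z $ i) * ((z - Z $ i) * \<bar>z - Z $ i\<bar>))) has_real_derivative
      (\<Sum>i\<in>UNIV. \<delta> $ i * (3 * ((z - Z $ i) * \<bar>z - Z $ i\<bar>)))) (at z)"
    by (intro DERIV_sum DERIV_cmult)
  then have "((\<lambda>z. a\<^sub>0 + a\<^sub>1 * z + 1/12 * (\<Sum>i\<in>UNIV. \<delta> $ i * ((z - Z $ i) * ((z - Z $ i) * \<bar>z - Z $ i\<bar>))))
      has_real_derivative 0 + a\<^sub>1 * 1 + 1/12 * (\<Sum>i\<in>UNIV. \<delta> $ i * (3 * ((z - Z $ i) * \<bar>z - Z $ i\<bar>)))) (at z)"
    by (intro DERIV_add DERIV_cmult DERIV_const DERIV_ident)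
  ultimately show ?thesis
    by (simp add: cubic_form_deriv_def mult.left_commute[of _ 3] sum_distrib_left[symmetric])
qed

lemma cubic_form_deriv_has_derivative:
  "(cubic_form_deriv Z a\<^sub>1 \<delta> has_real_derivative cubic_form_deriv2 Z \<delta> z) (at z)"
proof -
  have "((\<lambda>z. a\<^sub>1 + 1/4 * (\<Sum>i\<in>UNIV. \<delta> $ i * ((z - Z $ i) * \<bar>z - Z $ i\<bar>))) has_real_derivative
      0 + 1/4 * (\<Sum>i\<in>UNIV. \<delta> $ i * (2 * \<bar>z - Z $ i\<bar>))) (at z)"
    by (intro DERIV_add DERIV_cmult DERIV_const DERIV_sum has_real_derivative_diff_mult_abs)
  then show ?thesis
    by (simp add: cubic_form_deriv_def[abs_def] cubic_form_deriv2_def mult.left_commute[of _ 2] sum_distrib_left[symmetric])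
qed

lemma continuous_on_cubic_form_deriv2 [continuous_intros]: "continuous_on S (cubic_form_deriv2 Z \<delta>)"
  unfolding cubic_form_deriv2_def by (intro continuous_intros)

lemma abs_continuous_on_lipschitz:
  assumes "L \<ge> 0" and lip: "\<And>x y. x \<in> {A..B} \<Longrightarrow> y \<in> {A..B} \<Longrightarrow> \<bar>f x - f y\<bar> \<le> L * \<bar>x - y\<bar>"
  shows "abs_continuous_on {A..B} f"
  unfolding abs_continuous_on_iff_modulus
proof (intro allI impI)
  fix \<epsilon> :: real assume "\<epsilon> > 0"
  have "(\<Sum>K\<in>D. \<bar>f (Sup K) - f (Inf K)\<bar>) < \<epsilon>"
    \<comment> \<open>Dividing by \<open>L + 1\<close> admits \<open>L = 0\<close> and keeps the
      final inequality strict.\<close>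
    if D: "D division_of \<Union>D" "\<Union>D \<subseteq> {A..B}" and lt: "(\<Sum>K\<in>D. Sup K - Inf K) < \<epsilon> / (L + 1)" for D
  proof -
    have K: "Inf K \<le> Sup K \<and> {Inf K..Sup K} \<subseteq> {A..B}" if "K \<in> D" for K
      using nonoverlapping_division[OF D] that unfolding nonoverlapping_def by blast
    have "(\<Sum>K\<in>D. \<bar>f (Sup K) - f (Inf K)\<bar>) \<le> (\<Sum>K\<in>D. L * (Sup K - Inf K))"
    proof (rule sum_mono)
      fix K assume "K \<in> D"
      then show "\<bar>f (Sup K) - f (Inf K)\<bar> \<le> L * (Sup K - Inf K)"
        using lip[of "Sup K" "Inf K"] K[of K] by auto
    qed
    also have "\<dots> = L * (\<Sum>K\<in>D. Sup K - Inf K)" by (simp add: sum_distrib_left)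
    also have "\<dots> \<le> L * (\<epsilon> / (L + 1))" using lt \<open>L \<ge> 0\<close> by (intro mult_left_mono) auto
    also have "\<dots> < \<epsilon>" using \<open>L \<ge> 0\<close> \<open>\<epsilon> > 0\<close> by (simp add: field_simps)
    finally show ?thesis .
  qed
  then show "\<exists>\<delta>>0. ac_modulus {A..B} f \<epsilon> \<delta>"
    using \<open>L \<ge> 0\<close> \<open>\<epsilon> > 0\<close> unfolding ac_modulus_def by (intro exI[of _ "\<epsilon> / (L + 1)"]) auto
qed

lemma abs_continuous_on_cong:
  assumes "\<And>x. x \<in> {A..B} \<Longrightarrow> f x = g x" "abs_continuous_on {A..B} f"
  shows "abs_continuous_on {A..B} g"
  unfolding abs_continuous_on_iff_modulus
proof (intro allI impI)
  fix \<epsilon> :: real assume "\<epsilon> > 0"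
  then obtain d where d: "d > 0" "ac_modulus {A..B} f \<epsilon> d"
    using assms(2) unfolding abs_continuous_on_iff_modulus by blast
  have "(\<Sum>K\<in>D. \<bar>g (Sup K) - g (Inf K)\<bar>) = (\<Sum>K\<in>D. \<bar>f (Sup K) - f (Inf K)\<bar>)"
    if D: "D division_of \<Union>D" "\<Union>D \<subseteq> {A..B}" for D
  proof (rule sum.cong[OF refl])
    fix K assume "K \<in> D"
    then have "Inf K \<le> Sup K" "{Inf K..Sup K} \<subseteq> {A..B}"
      using nonoverlapping_division[OF D] unfolding nonoverlapping_def by blast+
    then show "\<bar>g (Sup K) - g (Inf K)\<bar> = \<bar>f (Sup K) - f (Inf K)\<bar>"
      using assms(1) by auto
  qed
  then have "ac_modulus {A..B} g \<epsilon> d" using d(2) unfolding ac_modulus_def by simp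
  with d(1) show "\<exists>d>0. ac_modulus {A..B} g \<epsilon> d" by blast
qed

lemma cubic_form_deriv01:
  assumes z: "z \<in> {0..1}"
  shows "(restrict (cubic_form Z a\<^sub>0 a\<^sub>1 \<delta>) {0..1} has_vector_derivative cubic_form_deriv Z a\<^sub>1 \<delta> z) (at z within {0..1})"
    and "deriv01 (restrict (cubic_form Z a\<^sub>0 a\<^sub>1 \<delta>) {0..1}) z = cubic_form_deriv Z a\<^sub>1 \<delta> z"
proof -
  have "(cubic_form Z a\<^sub>0 a\<^sub>1 \<delta> has_vector_derivative cubic_form_deriv Z a\<^sub>1 \<delta> z) (at z within {0..1})"
    using cubic_form_has_derivative[of Z a\<^sub>0 a\<^sub>1 \<delta> z]
    by (simp add: has_real_derivative_iff_has_vector_derivative has_vector_derivative_at_within)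
  then show d: "(restrict (cubic_form Z a\<^sub>0 a\<^sub>1 \<delta>) {0..1} has_vector_derivative cubic_form_deriv Z a\<^sub>1 \<delta> z) (at z within {0..1})"
    by (rule has_vector_derivative_transform[OF z, rotated]) auto
  show "deriv01 (restrict (cubic_form Z a\<^sub>0 a\<^sub>1 \<delta>) {0..1}) z = cubic_form_deriv Z a\<^sub>1 \<delta> z"
    unfolding deriv01_def by (rule vector_derivative_within_closed_interval[OF _ z d]) simp
qed

text \<open>The second derivative is continuous, hence bounded on \<open>{0..1}\<close>, so the
  first derivative is Lipschitz and therefore absolutely continuous.\<close>

lemma cubic_form_smooth_class: "restrict (cubic_form Z a\<^sub>0 a\<^sub>1 \<delta>) {0..1} \<in> smooth_class"
proof -
  let ?g = "restrict (cubic_form Z a\<^sub>0 a\<^sub>1 \<delta>) {0..1}"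
  have "?g differentiable_on {0..1}"
    unfolding differentiable_on_def using cubic_form_deriv01(1) by (blast intro: differentiableI_vector)
  moreover have "abs_continuous_on {0..1} (cubic_form_deriv Z a\<^sub>1 \<delta>)"
  proof -
    have "bounded (cubic_form_deriv2 Z \<delta> ` {0..1})"
      by (intro compact_imp_bounded compact_continuous_image continuous_on_cubic_form_deriv2 compact_Icc)
    then obtain L where L: "L > 0" "\<And>z. z \<in> {0..1} \<Longrightarrow> \<bar>cubic_form_deriv2 Z \<delta> z\<bar> \<le> L"
      unfolding bounded_pos by auto
    show ?thesis
    proof (rule abs_continuous_on_lipschitz)
      show "L \<ge> 0" using L by simp
      fix x y :: real assume "x \<in> {0..1}" "y \<in> {0..1}"
      then show "\<bar>cubic_form_deriv Z a\<^sub>1 \<delta> x - cubic_form_deriv Z a\<^sub>1 \<delta> y\<bar> \<le> L * \<bar>x - y\<bar>"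
        using field_differentiable_bound[of "{0..1}" "cubic_form_deriv Z a\<^sub>1 \<delta>" "cubic_form_deriv2 Z \<delta>" L x y] L(2)
          cubic_form_deriv_has_derivative[of Z a\<^sub>1 \<delta>]
        by (auto intro: has_field_derivative_at_within)
    qed
  qed
  then have "abs_continuous_on {0..1} (deriv01 ?g)"
    by (rule abs_continuous_on_cong[rotated]) (rule cubic_form_deriv01(2)[symmetric])
  ultimately show ?thesis unfolding smooth_class_def by auto
qed

lemma cubic_form_is_second_deriv:
  "is_second_deriv (restrict (cubic_form Z a\<^sub>0 a\<^sub>1 \<delta>) {0..1}) (cubic_form_deriv2 Z \<delta>)"
  unfolding is_second_deriv_def
proof (intro conjI ballI)
  show "set_integrable lborel {0..1} (cubic_form_deriv2 Z \<delta>)"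
    using borel_integrable_compact[OF compact_Icc continuous_on_cubic_form_deriv2] unfolding set_integrable_def by simp
  fix z :: real assume z: "z \<in> {0..1}"
  have "(LINT x:{0..z}|lborel. cubic_form_deriv2 Z \<delta> x) = cubic_form_deriv Z a\<^sub>1 \<delta> z - cubic_form_deriv Z a\<^sub>1 \<delta> 0"
    unfolding set_lebesgue_integral_def
  proof (rule integral_FTC_Icc)
    show "(cubic_form_deriv Z a\<^sub>1 \<delta> has_vector_derivative cubic_form_deriv2 Z \<delta> x) (at x within {0..z})" for x
      using cubic_form_deriv_has_derivative[of Z a\<^sub>1 \<delta> x]
      by (simp add: has_real_derivative_iff_has_vector_derivative has_vector_derivative_at_within)
  qed (use z in \<open>auto intro: continuous_on_cubic_form_deriv2\<close>)
  then show "deriv01 (restrict (cubic_form Z a\<^sub>0 a\<^sub>1 \<delta>) {0..1}) z - deriv01 (restrict (cubic_form Z a\<^sub>0 a\<^sub>1 \<delta>) {0..1}) 0 =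
      (LINT x:{0..z}|lborel. cubic_form_deriv2 Z \<delta> x)"
    using z by (simp add: cubic_form_deriv01(2))
qed

section \<open>Pairing values at the knots with second derivatives\<close>

lemma set_integrable_continuous_mult:
  fixes \<phi> h :: "real \<Rightarrow> real"
  assumes \<phi>: "continuous_on {a..b} \<phi>" and h: "set_integrable lborel {a..b} h"
  shows "set_integrable lborel {a..b} (\<lambda>z. \<phi> z * h z)"
proof -
  have "bounded (\<phi> ` {a..b})"
    by (intro compact_imp_bounded compact_continuous_image \<phi> compact_Icc)
  then obtain L where L: "L > 0" "\<And>z. z \<in> {a..b} \<Longrightarrow> \<bar>\<phi> z\<bar> \<le> L"
    unfolding bounded_pos by auto
  have [measurable]: "(\<lambda>z. indicator {a..b} z *\<^sub>R \<phi> z) \<in> borel_measurable lborel"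
    using borel_measurable_continuous_on_indicator[OF _ \<phi>] by simp
  have [measurable]: "(\<lambda>z. indicator {a..b} z *\<^sub>R h z) \<in> borel_measurable lborel"
    using h unfolding set_integrable_def by auto
  \<comment> \<open>Measurability of \<open>\<phi>\<close> and \<open>h\<close> is available only on
    \<open>{a..b}\<close>, so the product is taken of the truncated factors.\<close>
  have "(\<lambda>z. (indicator {a..b} z *\<^sub>R \<phi> z) * (indicator {a..b} z *\<^sub>R h z)) \<in> borel_measurable lborel"
    by measurable
  also have "(\<lambda>z. (indicator {a..b} z *\<^sub>R \<phi> z) * (indicator {a..b} z *\<^sub>R h z)) =
      (\<lambda>z. indicator {a..b} z *\<^sub>R (\<phi> z * h z))"
    by (auto simp: indicator_def)
  finally have m: "set_borel_measurable lborel {a..b} (\<lambda>z. \<phi> z * h z)"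
    unfolding set_borel_measurable_def .
  have "set_integrable lborel {a..b} (\<lambda>z. L * h z)" using h by simp
  then show ?thesis
  proof (rule set_integrable_bound[OF _ m])
    show "AE z in lborel. z \<in> {a..b} \<longrightarrow> norm (\<phi> z * h z) \<le> norm (L * h z)"
      using L by (auto simp: abs_mult intro!: mult_right_mono)
  qed
qed

text \<open>The weights \<open>\<delta>\<close> annihilate affine functions. This removes the affine
  part of Taylor's formula at the knots and leaves the weighted remainder kernels.\<close>

lemma sum_eq_integral_cubic_form_deriv2:
  fixes Z \<delta> :: "real^'n"
  assumes g: "g \<in> smooth_class" and h: "is_second_deriv g h" and Z: "\<And>i. Z $ i \<in> {0..1}"
    and d0: "(\<Sum>i\<in>UNIV. \<delta> $ i) = 0" and d1: "(\<Sum>i\<in>UNIV. \<delta> $ i * Z $ i) = 0"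
  shows "(\<Sum>i\<in>UNIV. \<delta> $ i * g (Z $ i)) = (LINT z:{0..1}|lborel. cubic_form_deriv2 Z \<delta> z * h z)"
proof -
  have hi: "set_integrable lborel {0..1} h" using h unfolding is_second_deriv_def by blast
  have int: "set_integrable lborel {0..1} (\<lambda>z. max 0 (x - z) * h z)" for x
    by (rule set_integrable_continuous_mult[OF _ hi]) (intro continuous_intros)
  have "(\<Sum>i\<in>UNIV. \<delta> $ i * g (Z $ i)) = (\<Sum>i\<in>UNIV. g 0 * \<delta> $ i + deriv01 g 0 * (\<delta> $ i * Z $ i) +
      \<delta> $ i * (LINT z:{0..1}|lborel. max 0 (Z $ i - z) * h z))"
    by (rule sum.cong[OF refl], subst smooth_class_taylor[OF g h Z]) (simp add: algebra_simps)
  also have "\<dots> = g 0 * (\<Sum>i\<in>UNIV. \<delta> $ i) + deriv01 g 0 * (\<Sum>i\<in>UNIV. \<delta> $ i * Z $ i) +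
      (\<Sum>i\<in>UNIV. \<delta> $ i * (LINT z:{0..1}|lborel. max 0 (Z $ i - z) * h z))"
    by (simp add: sum.distrib sum_distrib_left)
  also have "\<dots> = (\<Sum>i\<in>UNIV. LINT z:{0..1}|lborel. \<delta> $ i * (max 0 (Z $ i - z) * h z))"
    using d0 d1 by simp
  also have "\<dots> = (LINT z:{0..1}|lborel. (\<Sum>i\<in>UNIV. \<delta> $ i * (max 0 (Z $ i - z) * h z)))"
    using int unfolding set_lebesgue_integral_def set_integrable_def
    by (subst Bochner_Integration.integral_sum[symmetric]) (auto simp: sum_distrib_left mult.left_commute)
  also have "\<dots> = (LINT z:{0..1}|lborel. cubic_form_deriv2 Z \<delta> z * h z)"
  proof -
    have "(\<Sum>i\<in>UNIV. \<delta> $ i * max 0 (Z $ i - z)) = cubic_form_deriv2 Z \<delta> z" for z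
    proof -
      \<comment> \<open>\<open>max 0 (c - z)\<close> is half of
        \<open>\<bar>z - c\<bar> + c - z\<close>, and the weights annihilate the summand
        \<open>c - z\<close>.\<close>
      have "(\<Sum>i\<in>UNIV. \<delta> $ i * max 0 (Z $ i - z)) =
          (\<Sum>i\<in>UNIV. 1/2 * (\<delta> $ i * \<bar>z - Z $ i\<bar>) + 1/2 * (\<delta> $ i * Z $ i) - z / 2 * \<delta> $ i)"
        by (rule sum.cong) (auto simp: max_def abs_real_def field_simps)
      also have "\<dots> = cubic_form_deriv2 Z \<delta> z"
        by (simp only: sum.distrib sum_subtractf sum_distrib_left[symmetric] d0 d1 cubic_form_deriv2_def)
      finally show ?thesis .
    qed
    then show ?thesis by (simp add: mult.assoc[symmetric] sum_distrib_right[symmetric])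
  qed
  finally show ?thesis .
qed

text \<open>Between consecutive knots, and on either side of all knots, every
  \<open>z - Z $ i\<close> has a constant sign, so the cubes become polynomials. Outside the knots
  the sign is the same for all \<open>i\<close>, and the two conditions on \<open>\<delta>\<close>
  remove the cubic and quadratic terms.\<close>

lemma natural_cubic_spline_cubic_form:
  fixes Z \<delta> :: "real^'n"
  assumes d0: "(\<Sum>i\<in>UNIV. \<delta> $ i) = 0" and d1: "(\<Sum>i\<in>UNIV. \<delta> $ i * Z $ i) = 0"
  shows "natural_cubic_spline (range (\<lambda>i. Z $ i)) (cubic_form Z a\<^sub>0 a\<^sub>1 \<delta>)"
  unfolding natural_cubic_spline_def
proof (intro conjI ballI impI)
  let ?K = "range (\<lambda>i. Z $ i)"
  have affine: "\<exists>c d. \<forall>x. P x \<longrightarrow> cubic_form Z a\<^sub>0 a\<^sub>1 \<delta> x = c + d * x"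
    if abs: "\<And>x i. P x \<Longrightarrow> \<bar>x - Z $ i\<bar> = \<sigma> * (x - Z $ i)" for P and \<sigma> :: real
  proof (intro exI allI impI)
    fix x assume "P x"
    then have "(\<Sum>i\<in>UNIV. \<delta> $ i * \<bar>x - Z $ i\<bar> ^ 3) = (\<Sum>i\<in>UNIV. \<sigma>^3 * x^3 * \<delta> $ i - 3 * \<sigma>^3 * x^2 * (\<delta> $ i * Z $ i)
        + \<sigma>^3 * 3 * (\<delta> $ i * (Z $ i)^2) * x - \<sigma>^3 * (\<delta> $ i * (Z $ i)^3))"
      unfolding abs[OF \<open>P x\<close>] by (intro sum.cong refl) (simp add: power3_eq_cube power2_eq_square algebra_simps)
    also have "\<dots> = \<sigma>^3 * x^3 * (\<Sum>i\<in>UNIV. \<delta> $ i) - 3 * \<sigma>^3 * x^2 * (\<Sum>i\<in>UNIV. \<delta> $ i * Z $ i)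
        + \<sigma>^3 * 3 * (\<Sum>i\<in>UNIV. \<delta> $ i * (Z $ i)^2) * x - \<sigma>^3 * (\<Sum>i\<in>UNIV. \<delta> $ i * (Z $ i)^3)"
      by (simp only: sum.distrib sum_subtractf sum_distrib_left sum_distrib_right)
    finally show "cubic_form Z a\<^sub>0 a\<^sub>1 \<delta> x = (a\<^sub>0 - \<sigma>^3 * (\<Sum>i\<in>UNIV. \<delta> $ i * (Z $ i)^3) / 12)
        + (a\<^sub>1 + \<sigma>^3 * 3 * (\<Sum>i\<in>UNIV. \<delta> $ i * (Z $ i)^2) / 12) * x"
      unfolding cubic_form_def d0 d1 by (simp add: field_simps)
  qed
  show "\<exists>c d. \<forall>x\<le>Min ?K. cubic_form Z a\<^sub>0 a\<^sub>1 \<delta> x = c + d * x"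
  proof (rule affine[of _ "-1"])
    fix x i assume "x \<le> Min ?K"
    moreover have "Min ?K \<le> Z $ i" by simp
    ultimately show "\<bar>x - Z $ i\<bar> = - 1 * (x - Z $ i)" by simp
  qed
  show "\<exists>c d. \<forall>x\<ge>Max ?K. cubic_form Z a\<^sub>0 a\<^sub>1 \<delta> x = c + d * x"
  proof (rule affine[of _ 1])
    fix x i assume "x \<ge> Max ?K"
    moreover have "Z $ i \<le> Max ?K" by simp
    ultimately show "\<bar>x - Z $ i\<bar> = 1 * (x - Z $ i)" by simp
  qed
  show "\<exists>s' s''. (\<forall>x. (cubic_form Z a\<^sub>0 a\<^sub>1 \<delta> has_real_derivative s' x) (at x)) \<and>
        (\<forall>x. (s' has_real_derivative s'' x) (at x)) \<and> continuous_on UNIV s''"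
    using cubic_form_has_derivative cubic_form_deriv_has_derivative continuous_on_cubic_form_deriv2 by blast
  fix a b assume ab: "a \<in> ?K" "b \<in> ?K" "a < b \<and> ?K \<inter> {a<..<b} = {}"
  \<comment> \<open>The sign of \<open>x - Z $ i\<close> for \<open>x\<close> between
    \<open>a\<close> and \<open>b\<close>, as no knot lies strictly between them.\<close>
  define \<sigma> :: "'n \<Rightarrow> real" where "\<sigma> i = (if Z $ i \<le> a then 1 else -1)" for i
  define p where "p = [:a\<^sub>0, a\<^sub>1:] + smult (1/12) (\<Sum>i\<in>UNIV. smult (\<delta> $ i * \<sigma> i) ([:- Z $ i, 1:] ^ 3))"
  have "degree ([:- Z $ i, 1:] ^ 3) \<le> 3" for i
    using degree_power_le[of "[:- Z $ i, 1:]" 3] by simp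
  then have "degree (\<Sum>i\<in>UNIV. smult (\<delta> $ i * \<sigma> i) ([:- Z $ i, 1:] ^ 3)) \<le> 3"
    by (intro degree_sum_le) (auto intro: order.trans[OF degree_smult_le])
  then have "degree p \<le> 3"
    unfolding p_def by (intro degree_add_le order.trans[OF degree_smult_le]) auto
  moreover have "cubic_form Z a\<^sub>0 a\<^sub>1 \<delta> x = poly p x" if x: "x \<in> {a..b}" for x
  proof -
    have "\<bar>x - Z $ i\<bar> ^ 3 = \<sigma> i * (x - Z $ i) ^ 3" for i
    proof (cases "Z $ i \<le> a")
      case True
      then show ?thesis using x unfolding \<sigma>_def by simp
    next
      case False
      moreover have "Z $ i \<notin> {a<..<b}" using ab(3) by blast
      ultimately have "b \<le> Z $ i" by simp
      then have "\<bar>x - Z $ i\<bar> = - (x - Z $ i)" using x by simp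
      then show ?thesis using False unfolding \<sigma>_def by (simp add: power3_eq_cube algebra_simps)
    qed
    then show ?thesis
      unfolding cubic_form_def p_def by (simp add: poly_sum poly_power mult.assoc algebra_simps)
  qed
  ultimately show "\<exists>p. degree p \<le> 3 \<and> (\<forall>x\<in>{a..b}. cubic_form Z a\<^sub>0 a\<^sub>1 \<delta> x = poly p x)" by blast
qed

section \<open>The weight matrix\<close>

lemma exp_inner_inj:
  fixes v w :: "'a::real_inner"
  assumes "\<And>t. exp (\<i> * complex_of_real (v \<bullet> t)) = exp (\<i> * complex_of_real (w \<bullet> t))"
  shows "v = w"
proof (rule ccontr)
  assume "v \<noteq> w"
  then have nz: "(v - w) \<bullet> (v - w) \<noteq> 0" by simp
  \<comment> \<open>Scaled so that the phases of the two characters differ by \<open>pi\<close>,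
    which gives them opposite values.\<close>
  define t where "t = (pi / ((v - w) \<bullet> (v - w))) *\<^sub>R (v - w)"
  have "(v - w) \<bullet> t = pi" using nz unfolding t_def by (simp only: inner_scaleR_right) simp
  then have "v \<bullet> t = w \<bullet> t + pi" by (simp add: inner_diff_left)
  then have "exp (\<i> * complex_of_real (v \<bullet> t)) = - exp (\<i> * complex_of_real (w \<bullet> t))"
    by (simp add: distrib_left exp_add)
  then show False using assms[of t] by simp
qed

text \<open>Artin's argument: shifting \<open>t\<close> and subtracting eliminates one character at a time.\<close>

lemma exp_inner_independent:
  fixes w :: "'i \<Rightarrow> 'a::real_inner" and c :: "'i \<Rightarrow> complex"
  assumes "finite S" "inj_on w S" "\<And>t. (\<Sum>i\<in>S. c i * exp (\<i> * complex_of_real (w i \<bullet> t))) = 0" "i \<in> S"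
  shows "c i = 0"
  using assms
proof (induction S arbitrary: c i rule: finite_induct)
  case (insert a S)
  let ?\<chi> = "\<lambda>i t. exp (\<i> * complex_of_real (w i \<bullet> t))"
  have c0: "c j = 0" if j: "j \<in> S" for j
  proof -
    have "c j * (?\<chi> j s - ?\<chi> a s) = 0" for s
    proof (rule insert.IH[OF _ _ j])
      show "inj_on w S" using insert.prems(1) by simp
      fix t
      have "(\<Sum>i\<in>insert a S. c i * ?\<chi> i (s + t)) - ?\<chi> a s * (\<Sum>i\<in>insert a S. c i * ?\<chi> i t) = 0"
        using insert.prems(2) by simp
      then have "(\<Sum>i\<in>insert a S. c i * (?\<chi> i s - ?\<chi> a s) * ?\<chi> i t) = 0"
        by (simp only: sum_distrib_left sum_subtractf[symmetric])
           (simp add: inner_add_right distrib_left exp_add algebra_simps)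
      then show "(\<Sum>i\<in>S. c i * (?\<chi> i s - ?\<chi> a s) * ?\<chi> i t) = 0"
        using insert.hyps by simp
    qed
    \<comment> \<open>A nonzero coefficient would make the characters of \<open>j\<close> and
      \<open>a\<close> agree everywhere, against injectivity of \<open>w\<close>.\<close>
    then have "?\<chi> j s = ?\<chi> a s" if "c j \<noteq> 0" for s using that by simp
    then have "w j = w a" if "c j \<noteq> 0" using exp_inner_inj that by blast
    then show ?thesis using insert.prems(1) insert.hyps j by (auto simp: inj_on_def)
  qed
  have "(\<Sum>i\<in>insert a S. c i * ?\<chi> i 0) = 0" using insert.prems(2) by blast
  then have "c a = 0" using insert.hyps c0 by simp
  then show ?case using c0 insert.prems(3) by blast
qed simp

section \<open>The quadratic form of the weight matrix\<close>

text \<open>The Fourier transform of the signed measure with mass \<open>r $ i\<close> divided by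
  the sample size at \<open>W $ i\<close>; for the residual vector it is the integrand of the data
  term before taking the squared modulus.\<close>

definition weighted_cf :: "real^'p^'n \<Rightarrow> real^'n \<Rightarrow> real^'p \<Rightarrow> complex" where
  "weighted_cf W r t = 1 / of_nat CARD('n) *
     (\<Sum>i\<in>UNIV. complex_of_real (r $ i) * exp (\<i> * complex_of_real (W $ i \<bullet> t)))"

text \<open>Squares of real and imaginary part, combined by the formula for the cosine of a
  difference. Integrating over \<open>\<mu>\<close> term by term then produces the entries of
  \<open>Omega_matrix\<close>.\<close>

lemma cmod_weighted_cf_sq:
  fixes W :: "real^'p^'n"
  shows "(cmod (weighted_cf W r t))\<^sup>2 =
    (\<Sum>i\<in>UNIV. \<Sum>j\<in>UNIV. r $ i * (r $ j * (cos (t \<bullet> (W $ i - W $ j)) / (real CARD('n))\<^sup>2)))"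
proof -
  let ?S = "\<Sum>i\<in>UNIV. complex_of_real (r $ i) * exp (\<i> * complex_of_real (W $ i \<bullet> t))"
  have "(cmod ?S)\<^sup>2 = (\<Sum>i\<in>UNIV. r $ i * cos (W $ i \<bullet> t))\<^sup>2 + (\<Sum>i\<in>UNIV. r $ i * sin (W $ i \<bullet> t))\<^sup>2"
    by (simp add: cmod_power2 Re_exp Im_exp)
  also have "\<dots> = (\<Sum>i\<in>UNIV. \<Sum>j\<in>UNIV. r $ i * cos (W $ i \<bullet> t) * (r $ j * cos (W $ j \<bullet> t)) +
      r $ i * sin (W $ i \<bullet> t) * (r $ j * sin (W $ j \<bullet> t)))"
    by (simp add: power2_eq_square sum_product sum.distrib)
  also have "\<dots> = (\<Sum>i\<in>UNIV. \<Sum>j\<in>UNIV. r $ i * (r $ j * cos (t \<bullet> (W $ i - W $ j))))"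
    by (intro sum.cong refl) (simp add: inner_diff_right inner_commute cos_diff algebra_simps)
  finally show ?thesis
    unfolding weighted_cf_def norm_mult power_mult_distrib
    by (simp add: power_divide sum_distrib_left sum_divide_distrib norm_divide)
qed

lemma continuous_on_weighted_cf: "continuous_on UNIV (weighted_cf W r)"
  unfolding weighted_cf_def by (intro continuous_intros)

context
  fixes \<mu> :: "(real^'p) measure" and W :: "real^'p^'n"
  assumes prob: "prob_space \<mu>" and sets_\<mu>: "sets \<mu> = sets borel"
begin

lemma integrable_cos_inner: "integrable \<mu> (\<lambda>t. cos (t \<bullet> w))"
proof -
  interpret prob_space \<mu> by (rule prob)
  have [measurable]: "(\<lambda>t. cos (t \<bullet> w)) \<in> borel_measurable \<mu>"
    unfolding measurable_cong_sets[OF sets_\<mu> refl] by measurable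
  show ?thesis by (rule integrable_const_bound[where B = 1]) auto
qed

lemma Omega_quadratic_form_has_integral:
  "has_bochner_integral \<mu> (\<lambda>t. (cmod (weighted_cf W r t))\<^sup>2) (r \<bullet> (Omega_matrix \<mu> W *v r))"
proof -
  have "has_bochner_integral \<mu>
      (\<lambda>t. \<Sum>i\<in>UNIV. \<Sum>j\<in>UNIV. r $ i * (r $ j * (cos (t \<bullet> (W $ i - W $ j)) / (real CARD('n))\<^sup>2)))
      (\<Sum>i\<in>UNIV. \<Sum>j\<in>UNIV. r $ i * (r $ j * (omega \<mu> (W $ i - W $ j) / (real CARD('n))\<^sup>2)))"
    unfolding omega_def
    by (intro has_bochner_integral_sum has_bochner_integral_mult_right has_bochner_integral_divide
        has_bochner_integral_integrable integrable_cos_inner)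
  moreover have "r \<bullet> (Omega_matrix \<mu> W *v r) =
      (\<Sum>i\<in>UNIV. \<Sum>j\<in>UNIV. r $ i * (r $ j * (omega \<mu> (W $ i - W $ j) / (real CARD('n))\<^sup>2)))"
    unfolding inner_vec_def matrix_vector_mult_def Omega_matrix_def
    by (simp add: sum_distrib_left mult_ac)
  ultimately show ?thesis unfolding cmod_weighted_cf_sq by simp
qed

lemma Omega_quadratic_form_nonneg: "0 \<le> r \<bullet> (Omega_matrix \<mu> W *v r)"
  using Omega_quadratic_form_has_integral[of r] unfolding has_bochner_integral_iff
  by (metis integral_nonneg_AE AE_I2 zero_le_power2)

lemma nn_integral_weighted_cf:
  "(\<integral>\<^sup>+t. ennreal ((cmod (weighted_cf W r t))\<^sup>2) \<partial>\<mu>) = ennreal (r \<bullet> (Omega_matrix \<mu> W *v r))"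
  using Omega_quadratic_form_has_integral[of r] unfolding has_bochner_integral_iff
  by (subst nn_integral_eq_integral) auto

text \<open>A vanishing integral makes \<open>weighted_cf W r\<close> zero almost everywhere. The
  set where it is nonzero is open and null, hence empty by full support, and independence of the
  characters gives \<open>r = 0\<close>.\<close>

lemma Omega_positive_definite:
  assumes supp: "measure_support \<mu> = UNIV" and W: "\<And>i j. i \<noteq> j \<Longrightarrow> W $ i \<noteq> W $ j"
    and zero: "r \<bullet> (Omega_matrix \<mu> W *v r) = 0"
  shows "r = 0"
proof -
  have int: "integrable \<mu> (\<lambda>t. (cmod (weighted_cf W r t))\<^sup>2)"
    and int0: "(\<integral>t. (cmod (weighted_cf W r t))\<^sup>2 \<partial>\<mu>) = 0"
    using Omega_quadratic_form_has_integral[of r] zero unfolding has_bochner_integral_iff by auto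
  have "AE t in \<mu>. weighted_cf W r t = 0"
    using integral_nonneg_eq_0_iff_AE[OF int] int0 by simp
  then have ae: "AE t in \<mu>. t \<notin> {t. weighted_cf W r t \<noteq> 0}" by simp
  have op: "open {t. weighted_cf W r t \<noteq> 0}"
    using continuous_on_weighted_cf[of W r] by (rule open_Collect_neq) (rule continuous_on_const)
  then have "{t. weighted_cf W r t \<noteq> 0} \<in> sets \<mu>" unfolding sets_\<mu> by simp
  then have "emeasure \<mu> {t. weighted_cf W r t \<noteq> 0} = 0"
    using ae AE_iff_measurable[of "{t. weighted_cf W r t \<noteq> 0}" \<mu> "\<lambda>t. weighted_cf W r t = 0"]
      sets_eq_imp_space_eq[OF sets_\<mu>] by simp
  then have "weighted_cf W r t = 0" for t
    using supp op unfolding measure_support_def by (metis (mono_tags, lifting) UNIV_I less_irrefl mem_Collect_eq)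
  then have "(\<Sum>i\<in>UNIV. complex_of_real (r $ i) * exp (\<i> * complex_of_real (W $ i \<bullet> t))) = 0" for t
    unfolding weighted_cf_def by simp
  then have "complex_of_real (r $ i) = 0" for i
    using exp_inner_independent[of UNIV "\<lambda>i. W $ i" "\<lambda>i. complex_of_real (r $ i)" i] W
    by (auto simp: inj_on_def)
  then show ?thesis by (simp add: vec_eq_iff)
qed

lemma transpose_Omega: "transpose (Omega_matrix \<mu> W) = Omega_matrix \<mu> W"
proof -
  have "omega \<mu> (v - w) = omega \<mu> (w - v)" for v w
  proof -
    have "cos (t \<bullet> (v - w)) = cos (t \<bullet> (w - v))" for t
      by (metis cos_minus inner_minus_right minus_diff_eq)
    then show ?thesis unfolding omega_def by simp
  qed
  then show ?thesis unfolding transpose_def Omega_matrix_def vec_eq_iff by simp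
qed

lemma Omega_self_adjoint: "u \<bullet> (Omega_matrix \<mu> W *v v) = (Omega_matrix \<mu> W *v u) \<bullet> v"
  using dot_lmul_matrix[of u "Omega_matrix \<mu> W" v] transpose_Omega
  by (metis vector_transpose_matrix)

lemma invertible_Omega:
  assumes "measure_support \<mu> = UNIV" "\<And>i j. i \<noteq> j \<Longrightarrow> W $ i \<noteq> W $ j"
  shows "invertible (Omega_matrix \<mu> W)"
proof -
  have "x = 0" if "Omega_matrix \<mu> W *v x = 0" for x
    using Omega_positive_definite[OF assms, of x] that by simp
  then show ?thesis
    using matrix_left_invertible_ker[of "Omega_matrix \<mu> W"] invertible_left_inverse[of "Omega_matrix \<mu> W"] by blast
qed

end

section \<open>The block system\<close>

lemma sum_UNIV_Plus:
  "(\<Sum>l\<in>(UNIV :: ('a::finite + 'b::finite) set). f l) = (\<Sum>i\<in>UNIV. f (Inl i)) + (\<Sum>j\<in>UNIV. f (Inr j))"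
  using sum.Plus[of "UNIV :: 'a set" "UNIV :: 'b set" f] by (simp add: UNIV_Plus_UNIV o_def)

lemma vec_join_nth [simp]: "vec_join u v $ Inl i = u $ i" "vec_join u v $ Inr j = v $ j"
  unfolding vec_join_def by simp_all

lemma vec_join_eq_iff: "vec_join u v = vec_join u' v' \<longleftrightarrow> u = u' \<and> v = v'"
  by (metis vec_join_nth vec_eq_iff)

lemma vec_join_surj: obtains u v where "x = vec_join u v"
proof
  show "x = vec_join (\<chi> i. x $ Inl i) (\<chi> j. x $ Inr j)"
    unfolding vec_join_def vec_eq_iff by (auto split: sum.split)
qed

lemma vec_join_zero: "vec_join 0 0 = 0"
  unfolding vec_join_def vec_eq_iff by (auto split: sum.split)

lemma block_matrix_mult_vec_join:
  fixes A :: "real^'k^'m" and B :: "real^'l^'m" and C :: "real^'k^'r" and D :: "real^'l^'r"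
  shows "block_matrix A B C D *v vec_join u v = vec_join (A *v u + B *v v) (C *v u + D *v v)"
  unfolding vec_eq_iff
proof
  fix l show "(block_matrix A B C D *v vec_join u v) $ l = vec_join (A *v u + B *v v) (C *v u + D *v v) $ l"
    by (cases l) (simp_all add: block_matrix_def matrix_vector_mult_def sum_UNIV_Plus)
qed

lemma L_matrix_mult_vec_join:
  "L_matrix X Z *v vec_join (vector [b0, b1]) \<gamma> = (\<chi> i. b0 + b1 * Z $ i + X $ i \<bullet> \<gamma>)"
  unfolding vec_eq_iff
  by (simp add: L_matrix_def matrix_vector_mult_def sum_UNIV_Plus sum_2 inner_vec_def)

lemma transpose_L_matrix_mult:
  fixes X :: "real^'q^'n"
  shows "transpose (L_matrix X Z) *v \<delta> =
     vec_join (vector [(\<Sum>i\<in>UNIV. \<delta> $ i), (\<Sum>i\<in>UNIV. \<delta> $ i * Z $ i)]) (\<Sum>i\<in>UNIV. \<delta> $ i *\<^sub>R X $ i)"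
  unfolding vec_eq_iff
proof
  fix l :: "2 + 'q"
  show "(transpose (L_matrix X Z) *v \<delta>) $ l =
     vec_join (vector [(\<Sum>i\<in>UNIV. \<delta> $ i), (\<Sum>i\<in>UNIV. \<delta> $ i * Z $ i)]) (\<Sum>i\<in>UNIV. \<delta> $ i *\<^sub>R X $ i) $ l"
  proof (cases l)
    case (Inl k)
    then show ?thesis using exhaust_2[of k]
      by (auto simp: L_matrix_def matrix_vector_mult_def transpose_def mult.commute)
  next
    case (Inr k)
    then show ?thesis by (simp add: L_matrix_def matrix_vector_mult_def transpose_def mult.commute)
  qed
qed

lemma vector_2_eta: "(u :: real^2) = vector [u $ 1, u $ 2]"
  unfolding vec_eq_iff by (simp add: forall_2)

section \<open>Residuals and nonsingularity of the block system\<close>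

definition residual :: "real^'n \<Rightarrow> real^'q^'n \<Rightarrow> real^'n \<Rightarrow> real^'q \<Rightarrow> (real \<Rightarrow> real) \<Rightarrow> real^'n" where
  "residual Y X Z \<gamma> g = (\<chi> i. Y $ i - X $ i \<bullet> \<gamma> - g (Z $ i))"

lemma objective_eq:
  assumes "prob_space \<mu>" "sets \<mu> = sets borel"
  shows "objective \<mu> lam Y X Z W \<gamma> g =
    ennreal (residual Y X Z \<gamma> g \<bullet> (Omega_matrix \<mu> W *v residual Y X Z \<gamma> g)) +
    ennreal lam * (\<integral>\<^sup>+ z\<in>{0..1}. ennreal (\<bar>second_deriv01 g z\<bar>\<^sup>2) \<partial>lborel)"
  unfolding objective_def nn_integral_weighted_cf[OF assms, symmetric] weighted_cf_def residual_def by simp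

lemma cubic_form_at_knot: "cubic_form Z a\<^sub>0 a\<^sub>1 \<delta> (Z $ i) = a\<^sub>0 + a\<^sub>1 * Z $ i + (E_matrix Z *v \<delta>) $ i"
  unfolding cubic_form_def E_matrix_def matrix_vector_mult_def by (simp add: sum_distrib_left mult_ac)

text \<open>The pairing identity is applied to the cubic form itself, with zero affine part; the
  right side becomes the integral of a square.\<close>

lemma E_matrix_quadratic_form_nonneg:
  fixes Z \<delta> :: "real^'n"
  assumes Z: "\<And>i. Z $ i \<in> {0..1}"
    and d0: "(\<Sum>i\<in>UNIV. \<delta> $ i) = 0" and d1: "(\<Sum>i\<in>UNIV. \<delta> $ i * Z $ i) = 0"
  shows "0 \<le> \<delta> \<bullet> (E_matrix Z *v \<delta>)"
proof -
  let ?g = "restrict (cubic_form Z 0 0 \<delta>) {0..1}"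
  have "?g (Z $ i) = (E_matrix Z *v \<delta>) $ i" for i using Z[of i] cubic_form_at_knot[of Z 0 0 \<delta> i] by simp
  then have "\<delta> \<bullet> (E_matrix Z *v \<delta>) = (\<Sum>i\<in>UNIV. \<delta> $ i * ?g (Z $ i))"
    unfolding inner_vec_def by simp
  also have "\<dots> = (LINT z:{0..1}|lborel. cubic_form_deriv2 Z \<delta> z * cubic_form_deriv2 Z \<delta> z)"
    by (rule sum_eq_integral_cubic_form_deriv2[OF cubic_form_smooth_class cubic_form_is_second_deriv Z d0 d1])
  also have "\<dots> \<ge> 0" unfolding set_lebesgue_integral_def by (intro integral_nonneg_AE) auto
  finally show ?thesis .
qed

lemma full_column_rank_kernel:
  fixes X :: "real^'q^'n" and Z :: "real^'n"
  assumes "rank (L_matrix X Z) = CARD('q) + 2" "L_matrix X Z *v a = 0"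
  shows "a = 0"
proof -
  have "inj ((*v) (L_matrix X Z))" using assms(1) by (subst full_rank_injective[symmetric]) simp
  then show ?thesis using assms(2) by (metis injD matrix_vector_mult_0_right)
qed

text \<open>The first two equations are the spline conditions on \<open>\<delta>\<close>; the third
  removes the covariates from the cross term of the objective.\<close>

lemma transpose_L_matrix_kernel:
  assumes "transpose (L_matrix X Z) *v \<delta> = 0"
  shows "(\<Sum>i\<in>UNIV. \<delta> $ i) = 0" "(\<Sum>i\<in>UNIV. \<delta> $ i * Z $ i) = 0" "(\<Sum>i\<in>UNIV. \<delta> $ i *\<^sub>R X $ i) = 0"
proof -
  have "vector [(\<Sum>i\<in>UNIV. \<delta> $ i), (\<Sum>i\<in>UNIV. \<delta> $ i * Z $ i)] = (0 :: real^2) \<and>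
      (\<Sum>i\<in>UNIV. \<delta> $ i *\<^sub>R X $ i) = 0"
    using assms unfolding transpose_L_matrix_mult vec_join_zero[symmetric] vec_join_eq_iff .
  then show "(\<Sum>i\<in>UNIV. \<delta> $ i) = 0" "(\<Sum>i\<in>UNIV. \<delta> $ i * Z $ i) = 0" "(\<Sum>i\<in>UNIV. \<delta> $ i *\<^sub>R X $ i) = 0"
    by (metis vector_2(1) zero_index, metis vector_2(2) zero_index, blast)
qed

lemma block_system_iff:
  fixes A :: "real^'k^'m" and B :: "real^'l^'m" and C :: "real^'k^'r"
  shows "block_matrix A B C (0 :: real^'l^'r) *v vec_join u v = vec_join y z \<longleftrightarrow> A *v u + B *v v = y \<and> C *v u = z"
  unfolding block_matrix_mult_vec_join vec_join_eq_iff by simp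

lemma mult_matrix_inv_vec:
  fixes A :: "real^'n^'n"
  assumes "invertible A"
  shows "A *v (matrix_inv A *v x) = x"
proof -
  have "A ** matrix_inv A = mat 1"
    using assms someI_ex[of "\<lambda>B. A ** B = mat 1 \<and> B ** A = mat 1"] unfolding invertible_def matrix_inv_def by blast
  then show ?thesis by (metis matrix_vector_mul_assoc matrix_vector_mul_lid)
qed

text \<open>Pairing the first block row with \<open>\<delta>\<close> eliminates \<open>a\<close> by
  the second row. What remains is a sum of two nonnegative terms, so both vanish; this gives
  \<open>\<delta> = 0\<close>, and the rank condition gives \<open>a = 0\<close>.\<close>

lemma block_system_injective:
  fixes X :: "real^'q^'n" and W :: "real^'p^'n"
  assumes prob: "prob_space \<mu>" "sets \<mu> = sets borel"
    and supp: "measure_support \<mu> = UNIV" and W: "\<And>i j. i \<noteq> j \<Longrightarrow> W $ i \<noteq> W $ j"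
    and lam: "lam > 0" and Z: "\<And>i. Z $ i \<in> {0..1}"
    and rank: "rank (L_matrix X Z) = CARD('q) + 2"
    and ker: "block_matrix (E_tilde \<mu> lam Z W) (L_matrix X Z) (transpose (L_matrix X Z)) 0 *v x = 0"
  shows "x = 0"
proof -
  obtain \<delta> a where x: "x = vec_join \<delta> a" by (rule vec_join_surj)
  have eq1: "E_tilde \<mu> lam Z W *v \<delta> + L_matrix X Z *v a = 0"
    and eq2: "transpose (L_matrix X Z) *v \<delta> = 0"
    using ker block_system_iff[where y = 0 and z = 0] unfolding x vec_join_zero by blast+
  have d: "(\<Sum>i\<in>UNIV. \<delta> $ i) = 0" "(\<Sum>i\<in>UNIV. \<delta> $ i * Z $ i) = 0"
    using transpose_L_matrix_kernel[OF eq2] by simp_all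
  \<comment> \<open>With this substitution the form of the inverse matrix at \<open>\<delta>\<close>
    is the form of \<open>Omega_matrix\<close> at \<open>u\<close>, whose positivity is already
    known.\<close>
  define u where "u = matrix_inv (Omega_matrix \<mu> W) *v \<delta>"
  have du: "\<delta> = Omega_matrix \<mu> W *v u"
    unfolding u_def using mult_matrix_inv_vec[OF invertible_Omega[OF prob supp W]] by simp
  have "\<delta> \<bullet> (L_matrix X Z *v a) = (transpose (L_matrix X Z) *v \<delta>) \<bullet> a"
    by (metis dot_lmul_matrix matrix_vector_mul_linear transpose_matrix_vector)
  then have "\<delta> \<bullet> (E_tilde \<mu> lam Z W *v \<delta>) = 0"
    using arg_cong[OF eq1, of "\<lambda>v. \<delta> \<bullet> v"] eq2 by (simp add: inner_add_right)
  then have "\<delta> \<bullet> (E_matrix Z *v \<delta>) + lam * (u \<bullet> (Omega_matrix \<mu> W *v u)) = 0"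
    unfolding E_tilde_def u_def[symmetric]
    by (simp add: matrix_vector_mult_add_rdistrib scaleR_matrix_vector_assoc[symmetric] inner_add_right
        u_def[symmetric] inner_commute du[symmetric])
  moreover have "0 \<le> lam * (u \<bullet> (Omega_matrix \<mu> W *v u))"
    by (intro mult_nonneg_nonneg less_imp_le[OF lam] Omega_quadratic_form_nonneg[OF prob])
  ultimately have "u \<bullet> (Omega_matrix \<mu> W *v u) = 0"
    using E_matrix_quadratic_form_nonneg[OF Z d] lam by (smt (verit) mult_eq_0_iff)
  then have "u = 0" using Omega_positive_definite[OF prob supp W] by blast
  then have "\<delta> = 0" using du by simp
  moreover from this have "a = 0" using eq1 full_column_rank_kernel[OF rank] by simp
  ultimately show ?thesis unfolding x by (simp add: vec_join_zero)
qed

section \<open>Minimality of the spline\<close>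

text \<open>Taylor remainders of functions with almost everywhere equal second derivatives
  coincide.\<close>

lemma affine_of_second_derivs_eq:
  assumes g: "g \<in> smooth_class" "is_second_deriv g h" and k: "k \<in> smooth_class" "is_second_deriv k s"
    and ae: "AE z in lborel. z \<in> {0..1} \<longrightarrow> h z = s z" and x: "x \<in> {0..1}"
  shows "g x - k x = (g 0 - k 0) + (deriv01 g 0 - deriv01 k 0) * x"
proof -
  have int: "set_integrable lborel {0..1} (\<lambda>z. max 0 (x - z) * f z)"
    if "set_integrable lborel {0..1} f" for f :: "real \<Rightarrow> real"
    by (rule set_integrable_continuous_mult[OF _ that]) (intro continuous_intros)
  have "(LINT z:{0..1}|lborel. max 0 (x - z) * h z) = (LINT z:{0..1}|lborel. max 0 (x - z) * s z)"
    unfolding set_lebesgue_integral_def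
  proof (rule integral_cong_AE)
    show "AE z in lborel. indicat_real {0..1} z *\<^sub>R (max 0 (x - z) * h z) =
        indicat_real {0..1} z *\<^sub>R (max 0 (x - z) * s z)"
      using ae by eventually_elim (auto simp: indicator_def)
  qed (use g(2) k(2) int in \<open>auto simp: is_second_deriv_def set_integrable_def\<close>)
  then show ?thesis
    unfolding smooth_class_taylor[OF g x] smooth_class_taylor[OF k x] by (simp add: algebra_simps)
qed

text \<open>A finite penalty makes \<open>h\<close> square integrable, which permits expanding the
  square of \<open>s + (h - s)\<close>. The cross term is split into two integrals against
  \<open>s\<close>, the form that the pairing identity evaluates.\<close>

lemma penalty_expansion:
  fixes h s :: "real \<Rightarrow> real"
  assumes h: "set_integrable lborel {0..1} h" and s: "continuous_on {0..1} s"
    and fin: "(\<integral>\<^sup>+z\<in>{0..1}. ennreal (\<bar>h z\<bar>\<^sup>2) \<partial>lborel) < \<infinity>"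
  shows "set_integrable lborel {0..1} (\<lambda>z. (h z - s z)\<^sup>2)"
    and "(\<integral>\<^sup>+z\<in>{0..1}. ennreal (\<bar>h z\<bar>\<^sup>2) \<partial>lborel) = ennreal (LINT z:{0..1}|lborel. (h z)\<^sup>2)"
    and "(LINT z:{0..1}|lborel. (h z)\<^sup>2) = (LINT z:{0..1}|lborel. (s z)\<^sup>2) +
      2 * ((LINT z:{0..1}|lborel. s z * h z) - (LINT z:{0..1}|lborel. s z * s z)) +
      (LINT z:{0..1}|lborel. (h z - s z)\<^sup>2)"
proof -
  have ss: "set_integrable lborel {0..1} (\<lambda>z. s z * s z)"
    using borel_integrable_compact[OF compact_Icc continuous_on_mult[OF s s]] unfolding set_integrable_def by simp
  have sh: "set_integrable lborel {0..1} (\<lambda>z. s z * h z)"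
    by (rule set_integrable_continuous_mult[OF s h])
  have [measurable]: "(\<lambda>z. indicator {0..1} z *\<^sub>R h z) \<in> borel_measurable lborel"
    using h unfolding set_integrable_def by auto
  have sq: "(indicator {0..1} z *\<^sub>R h z)\<^sup>2 = indicator {0..1} z *\<^sub>R (h z)\<^sup>2" for z :: real
    by (auto simp: indicator_def)
  have "(\<lambda>z. (indicator {0..1} z *\<^sub>R h z)\<^sup>2) \<in> borel_measurable lborel" by measurable
  then have m: "(\<lambda>z. indicator {0..1} z *\<^sub>R (h z)\<^sup>2) \<in> borel_measurable lborel" unfolding sq .
  have nn: "(\<integral>\<^sup>+z\<in>{0..1}. ennreal (\<bar>h z\<bar>\<^sup>2) \<partial>lborel) = (\<integral>\<^sup>+z. ennreal (indicator {0..1} z *\<^sub>R (h z)\<^sup>2) \<partial>lborel)"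
    by (rule nn_integral_cong) (auto simp: indicator_def)
  have hh: "set_integrable lborel {0..1} (\<lambda>z. (h z)\<^sup>2)"
    unfolding set_integrable_def using fin unfolding nn
    by (intro integrableI_nonneg m) auto
  have exp: "(h z - s z)\<^sup>2 = ((h z)\<^sup>2 - 2 * (s z * h z)) + s z * s z" for z
    by (simp add: power2_eq_square algebra_simps)
  have d: "set_integrable lborel {0..1} (\<lambda>z. (h z)\<^sup>2 - 2 * (s z * h z))"
    using hh sh by (intro set_integral_diff(1)) auto
  show "set_integrable lborel {0..1} (\<lambda>z. (h z - s z)\<^sup>2)"
    unfolding exp using d ss by (rule set_integral_add(1))
  have "(LINT z:{0..1}|lborel. (h z - s z)\<^sup>2) = (LINT z:{0..1}|lborel. (h z)\<^sup>2)
      - 2 * (LINT z:{0..1}|lborel. s z * h z) + (LINT z:{0..1}|lborel. s z * s z)"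
    unfolding exp using set_integral_add(2)[OF d ss] set_integral_diff(2)[OF hh, of "\<lambda>z. 2 * (s z * h z)"] sh by simp
  then show "(LINT z:{0..1}|lborel. (h z)\<^sup>2) = (LINT z:{0..1}|lborel. (s z)\<^sup>2) +
      2 * ((LINT z:{0..1}|lborel. s z * h z) - (LINT z:{0..1}|lborel. s z * s z)) +
      (LINT z:{0..1}|lborel. (h z - s z)\<^sup>2)"
    by (simp add: power2_eq_square[of "s _"])
  show "(\<integral>\<^sup>+z\<in>{0..1}. ennreal (\<bar>h z\<bar>\<^sup>2) \<partial>lborel) = ennreal (LINT z:{0..1}|lborel. (h z)\<^sup>2)"
    unfolding nn set_lebesgue_integral_def
    by (rule nn_integral_eq_integral) (use hh in \<open>auto simp: set_integrable_def\<close>)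
qed

section \<open>The minimizer obtained from the block system\<close>

text \<open>An arbitrary solution of the block system is fixed: \<open>fit\<close> is its first
  block row and \<open>orth\<close> its second.\<close>

locale spline_solution =
  fixes \<mu> :: "(real^'p) measure" and lam :: real
    and Y :: "real^'n" and X :: "real^'q^'n" and Z :: "real^'n" and W :: "real^'p^'n"
    and a\<^sub>0 a\<^sub>1 :: real and \<delta> :: "real^'n" and \<gamma>h :: "real^'q"
  assumes Z: "\<And>i. Z $ i \<in> {0..1}"
    and prob: "prob_space \<mu>" and sets_\<mu>: "sets \<mu> = sets borel"
    and supp: "measure_support \<mu> = UNIV" and lam: "lam > 0"
    and W: "\<And>i j. i \<noteq> j \<Longrightarrow> W $ i \<noteq> W $ j"
    and rank: "rank (L_matrix X Z) = CARD('q) + 2"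
    and fit: "E_tilde \<mu> lam Z W *v \<delta> + L_matrix X Z *v vec_join (vector [a\<^sub>0, a\<^sub>1]) \<gamma>h = Y"
    and orth: "transpose (L_matrix X Z) *v \<delta> = 0"
begin

abbreviation "gh \<equiv> restrict (cubic_form Z a\<^sub>0 a\<^sub>1 \<delta>) {0..1}"
abbreviation "sh \<equiv> cubic_form_deriv2 Z \<delta>"
abbreviation "Q r \<equiv> r \<bullet> (Omega_matrix \<mu> W *v r)"
text \<open>The minimal value as a real number, so that it can be used in ordinary
  arithmetic.\<close>

abbreviation "J \<equiv> Q (residual Y X Z \<gamma>h gh) + lam * (LINT z:{0..1}|lborel. (sh z)\<^sup>2)"

lemma Q_nonneg: "0 \<le> Q r"
  by (rule Omega_quadratic_form_nonneg[OF prob sets_\<mu>])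

lemma penalty_nonneg: "0 \<le> lam * (LINT z:{0..1}|lborel. (f z)\<^sup>2)"
  unfolding set_lebesgue_integral_def by (intro mult_nonneg_nonneg less_imp_le[OF lam] integral_nonneg_AE) auto

lemma J_nonneg: "0 \<le> J"
  by (rule add_nonneg_nonneg[OF Q_nonneg penalty_nonneg])

text \<open>At the knots, \<open>fit\<close> says that the residual is \<open>lam\<close> times the
  inverse of \<open>Omega_matrix\<close> applied to \<open>\<delta>\<close>. This is the
  stationarity condition of the problem.\<close>

lemma Omega_residual_eq: "Omega_matrix \<mu> W *v residual Y X Z \<gamma>h gh = lam *\<^sub>R \<delta>"
proof -
  have "residual Y X Z \<gamma>h gh = lam *\<^sub>R (matrix_inv (Omega_matrix \<mu> W) *v \<delta>)"
    unfolding vec_eq_iff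
  proof
    fix i
    have "Y $ i = (E_matrix Z *v \<delta>) $ i + lam * (matrix_inv (Omega_matrix \<mu> W) *v \<delta>) $ i
        + (a\<^sub>0 + a\<^sub>1 * Z $ i + X $ i \<bullet> \<gamma>h)"
      using fit[symmetric] unfolding L_matrix_mult_vec_join E_tilde_def
      by (simp add: matrix_vector_mult_add_rdistrib scaleR_matrix_vector_assoc[symmetric])
    then show "residual Y X Z \<gamma>h gh $ i = (lam *\<^sub>R (matrix_inv (Omega_matrix \<mu> W) *v \<delta>)) $ i"
      unfolding residual_def using Z[of i] cubic_form_at_knot[of Z a\<^sub>0 a\<^sub>1 \<delta> i] by simp
  qed
  then show ?thesis
    by (simp add: matrix_vector_mult_scaleR mult_matrix_inv_vec[OF invertible_Omega[OF prob sets_\<mu> supp W]])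
qed

text \<open>The density chosen by \<open>second_deriv01\<close> may differ from \<open>sh\<close>,
  but only on a null set.\<close>

lemma objective_spline: "objective \<mu> lam Y X Z W \<gamma>h gh = ennreal J"
proof -
  have int: "set_integrable lborel {0..1} (\<lambda>z. (sh z)\<^sup>2)"
    using borel_integrable_compact[OF compact_Icc continuous_on_power[OF continuous_on_cubic_form_deriv2]]
    unfolding set_integrable_def by simp
  have "(\<integral>\<^sup>+z\<in>{0..1}. ennreal (\<bar>second_deriv01 gh z\<bar>\<^sup>2) \<partial>lborel) = (\<integral>\<^sup>+z. ennreal (indicator {0..1} z *\<^sub>R (sh z)\<^sup>2) \<partial>lborel)"
  proof (rule nn_integral_cong_AE)
    show "AE z in lborel. ennreal (\<bar>second_deriv01 gh z\<bar>\<^sup>2) * indicator {0..1} z = ennreal (indicator {0..1} z *\<^sub>R (sh z)\<^sup>2)"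
      using is_second_deriv_unique[OF second_deriv01_works[OF cubic_form_smooth_class] cubic_form_is_second_deriv,
          of Z a\<^sub>0 a\<^sub>1 \<delta>]
      by eventually_elim (auto simp: indicator_def)
  qed
  also have "\<dots> = ennreal (LINT z:{0..1}|lborel. (sh z)\<^sup>2)"
    unfolding set_lebesgue_integral_def
    by (rule nn_integral_eq_integral) (use int in \<open>auto simp: set_integrable_def\<close>)
  finally show ?thesis
    unfolding objective_eq[OF prob sets_\<mu>]
    using lam Q_nonneg[of "residual Y X Z \<gamma>h gh"] penalty_nonneg[of sh]
    by (simp add: ennreal_mult'[symmetric] ennreal_plus[symmetric] del: ennreal_plus)
qed

text \<open>The cross terms of fit and penalty cancel: \<open>\<Omega>\<close> maps the residual of the spline to \<open>\<lambda>\<delta>\<close>,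
  while pairing the second derivative of the spline with that of \<open>g - gh\<close> gives \<open>\<delta> \<bullet> (g - gh)(Z)\<close>.\<close>

lemma objective_expansion:
  assumes g: "g \<in> smooth_class" and fin: "objective \<mu> lam Y X Z W \<gamma> g < \<infinity>"
  defines "v \<equiv> residual Y X Z \<gamma>h gh - residual Y X Z \<gamma> g"
  shows "set_integrable lborel {0..1} (\<lambda>z. (second_deriv01 g z - sh z)\<^sup>2)"
    and "objective \<mu> lam Y X Z W \<gamma> g =
      ennreal (J + Q v + lam * (LINT z:{0..1}|lborel. (second_deriv01 g z - sh z)\<^sup>2))"
proof -
  let ?h = "second_deriv01 g" and ?r = "residual Y X Z \<gamma>h gh"
  let ?D = "LINT z:{0..1}|lborel. (?h z - sh z)\<^sup>2" and ?S = "LINT z:{0..1}|lborel. (sh z)\<^sup>2"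
  have h: "is_second_deriv g ?h" by (rule second_deriv01_works[OF g])
  then have hi: "set_integrable lborel {0..1} ?h" unfolding is_second_deriv_def by blast
  note d = transpose_L_matrix_kernel[OF orth]
  have "ennreal lam * (\<integral>\<^sup>+ z\<in>{0..1}. ennreal (\<bar>?h z\<bar>\<^sup>2) \<partial>lborel) < \<infinity>"
    using fin unfolding objective_eq[OF prob sets_\<mu>] by simp
  \<comment> \<open>Since \<open>lam\<close> is positive, a finite objective has a finite penalty
    integral.\<close>
  then have pen: "(\<integral>\<^sup>+ z\<in>{0..1}. ennreal (\<bar>?h z\<bar>\<^sup>2) \<partial>lborel) < \<infinity>"
    using lam by (auto simp: ennreal_mult_less_top)
  note ex = penalty_expansion[OF hi continuous_on_cubic_form_deriv2[of _ Z \<delta>] pen]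
  show "set_integrable lborel {0..1} (\<lambda>z. (?h z - sh z)\<^sup>2)" by (rule ex(1))
  \<comment> \<open>Changing \<open>\<gamma>\<close> does not affect the product of
    \<open>\<delta>\<close> and \<open>v\<close>, because \<open>\<delta>\<close> is orthogonal to
    the covariates.\<close>
  have "(\<Sum>i\<in>UNIV. \<delta> $ i * (X $ i \<bullet> (\<gamma> - \<gamma>h))) = (\<Sum>i\<in>UNIV. \<delta> $ i *\<^sub>R X $ i) \<bullet> (\<gamma> - \<gamma>h)"
    by (simp add: inner_sum_left)
  also have "\<dots> = 0" using d(3) by simp
  finally have dX: "(\<Sum>i\<in>UNIV. \<delta> $ i * (X $ i \<bullet> (\<gamma> - \<gamma>h))) = 0" .
  have "\<delta> \<bullet> v = (\<Sum>i\<in>UNIV. \<delta> $ i * (X $ i \<bullet> (\<gamma> - \<gamma>h)) + (\<delta> $ i * g (Z $ i) - \<delta> $ i * gh (Z $ i)))"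
    unfolding v_def residual_def inner_vec_def[of \<delta>]
    by (intro sum.cong refl) (simp add: inner_diff_right algebra_simps)
  also have "\<dots> = (\<Sum>i\<in>UNIV. \<delta> $ i * g (Z $ i)) - (\<Sum>i\<in>UNIV. \<delta> $ i * gh (Z $ i))"
    unfolding sum.distrib sum_subtractf dX by simp
  also have "\<dots> = (LINT z:{0..1}|lborel. sh z * ?h z) - (LINT z:{0..1}|lborel. sh z * sh z)"
    unfolding sum_eq_integral_cubic_form_deriv2[OF g h Z d(1,2)]
      sum_eq_integral_cubic_form_deriv2[OF cubic_form_smooth_class cubic_form_is_second_deriv Z d(1,2)] ..
  finally have dv: "(LINT z:{0..1}|lborel. sh z * ?h z) - (LINT z:{0..1}|lborel. sh z * sh z) = \<delta> \<bullet> v" by simp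
  have penv: "(\<integral>\<^sup>+ z\<in>{0..1}. ennreal (\<bar>?h z\<bar>\<^sup>2) \<partial>lborel) = ennreal (?S + 2 * (\<delta> \<bullet> v) + ?D)"
    unfolding ex(2) ex(3) dv ..
  \<comment> \<open>Needed to merge the two extended nonnegative summands into one real expression,
    as \<open>ennreal\<close> truncates negative numbers.\<close>
  have pen_nonneg: "0 \<le> ?S + 2 * (\<delta> \<bullet> v) + ?D"
  proof -
    have "0 \<le> (LINT z:{0..1}|lborel. (?h z)\<^sup>2)"
      unfolding set_lebesgue_integral_def by (intro integral_nonneg_AE) auto
    then show ?thesis unfolding ex(3) dv .
  qed
  have rg: "residual Y X Z \<gamma> g = ?r - v" unfolding v_def by simp
  \<comment> \<open>Both mixed terms equal \<open>lam\<close> times the product of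
    \<open>\<delta>\<close> and \<open>v\<close>, by symmetry of the matrix; together they cancel
    the cross term of the penalty.\<close>
  have "Q (?r - v) = Q ?r - ?r \<bullet> (Omega_matrix \<mu> W *v v) - v \<bullet> (Omega_matrix \<mu> W *v ?r) + Q v"
    by (simp add: matrix_vector_mult_diff_distrib inner_diff_left inner_diff_right)
  also have "\<dots> = Q ?r - 2 * lam * (\<delta> \<bullet> v) + Q v"
    unfolding Omega_self_adjoint[OF prob sets_\<mu>, where u = ?r and v = v] Omega_residual_eq by (simp add: inner_commute)
  finally have Qv: "Q (residual Y X Z \<gamma> g) = Q ?r - 2 * lam * (\<delta> \<bullet> v) + Q v" unfolding rg .
  have "objective \<mu> lam Y X Z W \<gamma> g = ennreal (Q (residual Y X Z \<gamma> g) + lam * (?S + 2 * (\<delta> \<bullet> v) + ?D))"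
    unfolding objective_eq[OF prob sets_\<mu>] penv
    using lam mult_nonneg_nonneg[OF less_imp_le[OF lam] pen_nonneg] Q_nonneg[of "residual Y X Z \<gamma> g"]
    by (simp add: ennreal_mult'[symmetric] ennreal_plus[symmetric] del: ennreal_plus)
  also have "\<dots> = ennreal (J + Q v + lam * ?D)"
    unfolding Qv by (simp add: algebra_simps)
  finally show "objective \<mu> lam Y X Z W \<gamma> g = ennreal (J + Q v + lam * ?D)" .
qed

lemma spline_minimal:
  assumes g: "g \<in> smooth_class"
  shows "objective \<mu> lam Y X Z W \<gamma>h gh \<le> objective \<mu> lam Y X Z W \<gamma> g"
proof (cases "objective \<mu> lam Y X Z W \<gamma> g < \<infinity>")
  case True
  show ?thesis
    unfolding objective_expansion(2)[OF g True] objective_spline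
    using Q_nonneg[of "residual Y X Z \<gamma>h gh - residual Y X Z \<gamma> g"]
      penalty_nonneg[of "\<lambda>z. second_deriv01 g z - sh z"]
    by (intro ennreal_leI) linarith
next
  case False
  then show ?thesis by (simp add: not_less top_unique)
qed

text \<open>Both excess terms must vanish, so \<open>v = 0\<close> and the second derivatives agree
  almost everywhere. Then \<open>g - gh\<close> is affine on \<open>{0..1}\<close>, and full column
  rank excludes any nonzero difference of parameters.\<close>

lemma spline_unique:
  assumes g: "g \<in> smooth_class" and le: "objective \<mu> lam Y X Z W \<gamma> g \<le> objective \<mu> lam Y X Z W \<gamma>h gh"
  shows "\<gamma> = \<gamma>h" and "g = gh"
proof -
  let ?h = "second_deriv01 g"
  let ?D = "LINT z:{0..1}|lborel. (?h z - sh z)\<^sup>2"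
  define v where "v = residual Y X Z \<gamma>h gh - residual Y X Z \<gamma> g"
  have fin: "objective \<mu> lam Y X Z W \<gamma> g < \<infinity>"
    using le_less_trans[OF le[unfolded objective_spline] ennreal_less_top] by simp
  note ex = objective_expansion[OF g fin, folded v_def]
  have "J + Q v + lam * ?D \<le> J"
    using le unfolding ex(2) objective_spline using J_nonneg by simp
  moreover have "0 \<le> Q v" "0 \<le> lam * ?D"
    by (rule Q_nonneg, rule penalty_nonneg)
  ultimately have "Q v = 0" "lam * ?D = 0" by linarith+
  then have v0: "v = 0" and D0: "?D = 0"
    using Omega_positive_definite[OF prob sets_\<mu> supp W] lam by simp_all
  have "AE z in lborel. indicator {0..1} z *\<^sub>R (?h z - sh z)\<^sup>2 = 0"
    using D0 ex(1) unfolding set_lebesgue_integral_def set_integrable_def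
    by (subst (asm) integral_nonneg_eq_0_iff_AE) auto
  then have ae: "AE z in lborel. z \<in> {0..1} \<longrightarrow> ?h z = sh z"
    by eventually_elim (auto simp: indicator_def)
  define b0 where "b0 = g 0 - gh 0"
  define b1 where "b1 = deriv01 g 0 - deriv01 gh 0"
  have aff: "g x - gh x = b0 + b1 * x" if "x \<in> {0..1}" for x
    unfolding b0_def b1_def
    by (rule affine_of_second_derivs_eq[OF g second_deriv01_works[OF g] cubic_form_smooth_class
        cubic_form_is_second_deriv ae that])
  \<comment> \<open>The difference of the residuals is \<open>L_matrix X Z\<close> applied to the
    difference of the parameters.\<close>
  have "b0 + b1 * Z $ i + X $ i \<bullet> (\<gamma> - \<gamma>h) = v $ i" for i
    using aff[OF Z[of i]] unfolding v_def residual_def by (simp add: inner_diff_right algebra_simps)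
  then have "L_matrix X Z *v vec_join (vector [b0, b1]) (\<gamma> - \<gamma>h) = 0"
    unfolding L_matrix_mult_vec_join v0 by (simp add: vec_eq_iff)
  from full_column_rank_kernel[OF rank this]
  have "vec_join (vector [b0, b1]) (\<gamma> - \<gamma>h) = vec_join (0 :: real^2) (0 :: real^'q)" unfolding vec_join_zero .
  then have b: "vector [b0, b1] = (0 :: real^2)" and "\<gamma> - \<gamma>h = 0" unfolding vec_join_eq_iff by simp_all
  then show "\<gamma> = \<gamma>h" by simp
  have "b0 = 0" "b1 = 0"
    using arg_cong[OF b, of "\<lambda>u. u $ 1"] arg_cong[OF b, of "\<lambda>u. u $ 2"] by simp_all
  then have "g x = gh x" if "x \<in> {0..1}" for x using aff[OF that] by simp
  \<comment> \<open>Off the unit interval both functions take the default value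
    \<open>undefined\<close>.\<close>
  moreover have "g \<in> extensional {0..1}" using g unfolding smooth_class_def by simp
  ultimately show "g = gh" by (intro extensionalityI[of _ "{0..1}"]) auto
qed

lemma is_solution_iff: "is_solution \<mu> lam Y X Z W \<gamma> g \<longleftrightarrow> \<gamma> = \<gamma>h \<and> g = gh"
proof
  assume "is_solution \<mu> lam Y X Z W \<gamma> g"
  then have g: "g \<in> smooth_class"
    and "\<not> objective \<mu> lam Y X Z W \<gamma>h gh < objective \<mu> lam Y X Z W \<gamma> g"
    using cubic_form_smooth_class[of Z a\<^sub>0 a\<^sub>1 \<delta>] unfolding is_solution_def is_arg_min_def by auto
  then show "\<gamma> = \<gamma>h \<and> g = gh" using spline_unique[OF g] by (simp add: not_less)
next
  assume eq: "\<gamma> = \<gamma>h \<and> g = gh"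
  have "\<not> objective \<mu> lam Y X Z W \<gamma>' g' < objective \<mu> lam Y X Z W \<gamma>h gh" if "g' \<in> smooth_class" for \<gamma>' g'
    using spline_minimal[OF that] by (simp add: not_less)
  then show "is_solution \<mu> lam Y X Z W \<gamma> g"
    unfolding is_solution_def is_arg_min_def using eq cubic_form_smooth_class[of Z a\<^sub>0 a\<^sub>1 \<delta>] by auto
qed

end

theorem proposition2:
  fixes \<mu> :: "(real^'p) measure"
    and lam :: real
    and Y :: "real^'n" and X :: "real^'q^'n" and Z :: "real^'n" and W :: "real^'p^'n"
  assumes "CARD('n) \<ge> 2"
    and "\<And>i. Z $ i \<in> {0..1}"
    and "prob_space \<mu>" and "sets \<mu> = sets borel"
    and "symmetric_measure \<mu>" and "measure_support \<mu> = UNIV"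
    and "lam > 0"
    and "\<And>i j. i \<noteq> j \<Longrightarrow> Z $ i \<noteq> Z $ j"
    and "\<And>i j. i \<noteq> j \<Longrightarrow> W $ i \<noteq> W $ j"
    and "rank (L_matrix X Z) = CARD('q) + 2"
  shows "invertible (Omega_matrix \<mu> W) \<and>
    (\<exists>\<gamma>h gh.
      (\<forall>\<gamma> g. is_solution \<mu> lam Y X Z W \<gamma> g \<longleftrightarrow> \<gamma> = \<gamma>h \<and> g = gh) \<and>
      (\<exists>a0 a1 \<delta>h.
        natural_cubic_spline (range (\<lambda>i. Z $ i)) (cubic_form Z a0 a1 \<delta>h) \<and>
        (\<forall>z\<in>{0..1}. gh z = cubic_form Z a0 a1 \<delta>h z) \<and>
        (\<forall>\<delta> a. block_matrix (E_tilde \<mu> lam Z W) (L_matrix X Z) (transpose (L_matrix X Z)) 0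
                  *v vec_join \<delta> a = vec_join Y 0
               \<longleftrightarrow> \<delta> = \<delta>h \<and> a = vec_join (vector [a0, a1]) \<gamma>h)))"
proof
  let ?B = "block_matrix (E_tilde \<mu> lam Z W) (L_matrix X Z) (transpose (L_matrix X Z)) 0"
  show "invertible (Omega_matrix \<mu> W)" using invertible_Omega assms(3,4,6,9) by blast
  have ker: "x = 0" if "?B *v x = 0" for x
    by (rule block_system_injective[OF assms(3,4,6,9,7,2,10) that])
  then have inj: "inj ((*v) ?B)" by (simp add: inj_matrix_vector_mult matrix_left_invertible_injective[symmetric] matrix_left_invertible_ker)
  \<comment> \<open>The block matrix is square, so the trivial kernel also yields existence of a
    solution.\<close>
  then have "surj ((*v) ?B)"
    using linear_injective_imp_surjective[OF matrix_vector_mul_linear] by blast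
  then obtain x where "?B *v x = vec_join Y 0" by (metis surjD)
  moreover obtain \<delta>h a where "x = vec_join \<delta>h a" by (rule vec_join_surj)
  \<comment> \<open>The lower block is split further: \<open>u\<close> holds the intercept and
    slope, \<open>\<gamma>h\<close> the covariate coefficients.\<close>
  moreover obtain u \<gamma>h where "a = vec_join u \<gamma>h" by (rule vec_join_surj)
  ultimately have sol: "?B *v vec_join \<delta>h (vec_join (vector [u $ 1, u $ 2]) \<gamma>h) = vec_join Y 0"
    by (metis vector_2_eta)
  then have fit: "E_tilde \<mu> lam Z W *v \<delta>h + L_matrix X Z *v vec_join (vector [u $ 1, u $ 2]) \<gamma>h = Y"
    and orth: "transpose (L_matrix X Z) *v \<delta>h = 0"
    unfolding block_system_iff by blast+
  interpret spline_solution \<mu> lam Y X Z W "u $ 1" "u $ 2" \<delta>h \<gamma>h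
    by (rule spline_solution.intro) (rule assms fit orth | assumption)+
  have uniq: "?B *v vec_join \<delta> a = vec_join Y 0 \<longleftrightarrow> \<delta> = \<delta>h \<and> a = vec_join (vector [u $ 1, u $ 2]) \<gamma>h" for \<delta> a
    using sol inj by (metis injD vec_join_eq_iff)
  show "\<exists>\<gamma>h gh.
      (\<forall>\<gamma> g. is_solution \<mu> lam Y X Z W \<gamma> g \<longleftrightarrow> \<gamma> = \<gamma>h \<and> g = gh) \<and>
      (\<exists>a0 a1 \<delta>h.
        natural_cubic_spline (range (\<lambda>i. Z $ i)) (cubic_form Z a0 a1 \<delta>h) \<and>
        (\<forall>z\<in>{0..1}. gh z = cubic_form Z a0 a1 \<delta>h z) \<and>
        (\<forall>\<delta> a. ?B *v vec_join \<delta> a = vec_join Y 0 \<longleftrightarrow> \<delta> = \<delta>h \<and> a = vec_join (vector [a0, a1]) \<gamma>h))"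
  proof (intro exI conjI)
    show "\<forall>\<gamma> g. is_solution \<mu> lam Y X Z W \<gamma> g \<longleftrightarrow>
        \<gamma> = \<gamma>h \<and> g = restrict (cubic_form Z (u $ 1) (u $ 2) \<delta>h) {0..1}"
      using is_solution_iff by blast
    show "natural_cubic_spline (range (\<lambda>i. Z $ i)) (cubic_form Z (u $ 1) (u $ 2) \<delta>h)"
      by (rule natural_cubic_spline_cubic_form[OF transpose_L_matrix_kernel(1,2)[OF orth]])
    show "\<forall>z\<in>{0..1}. restrict (cubic_form Z (u $ 1) (u $ 2) \<delta>h) {0..1} z = cubic_form Z (u $ 1) (u $ 2) \<delta>h z"
      by simp
    show "\<forall>\<delta> a. ?B *v vec_join \<delta> a = vec_join Y 0 \<longleftrightarrow> \<delta> = \<delta>h \<and> a = vec_join (vector [u $ 1, u $ 2]) \<gamma>h"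
      using uniq by blast
  qed
qed

end
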